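(* For any $N$-tuple of spins $\boldsymbol{\bar\jmath}=(j_1,\dots,j_N)$ and $v_i\in\mathbb C^*$, $1\le i\le N$, $$\tilde{\boldsymbol t}^{\frac12,\boldsymbol{\bar\jmath}}(u)=\prod_{n=1}^N\Big(c(uq^{j_n+\frac12}v_n)c(uq^{j_n+\frac12}v_n^{-1})\Big)^{-1}\Big[c(u^2)c(u^2q^2)\big(\psi(\mathsf I^{(N)}(u))+h_0^{(N)}(u)\mathsf I_0\big)+\bar\varepsilon_+\big((u^2q+u^{-2}q^{-1})\varepsilon_+^{(N)}+(q+q^{-1})\varepsilon_-^{(N)}\big)+\bar\varepsilon_-\big((u^2q+u^{-2}q^{-1})\varepsilon_-^{(N)}+(q+q^{-1})\varepsilon_+^{(N)}\big)\Big],$$ where $\psi=\psi^{(N)}_{\boldsymbol{\bar\jmath},\bar v}$. Furthermore $$\psi\big(\mathsf I^{(N)}(u)\big)=\sum_{k=0}^{N-1}P_{-k}^{(N)}(u)\,\psi\big(\mathsf I_{2k+1}^{(N)}\big),\qquad \psi\big(\mathsf I_{2k+1}^{(N)}\big)=\bar\varepsilon_+\mathcal W_{-k}^{(N)}+\bar\varepsilon_-\mathcal W_{k+1}^{(N)}+\frac1{q^2-q^{-2}}\frac{\bar k_-}{k_-}\mathcal G_{k+1}^{(N)}+\frac1{q^2-q^{-2}}\frac{\bar k_+}{k_+}\tilde{\mathcal G}_{k+1}^{(N)},$$ where $\mathcal W_{-k}^{(N)},\mathcal W_{k+1}^{(N)},\mathcal G_{k+1}^{(N)},\tilde{\mathcal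 G}_{k+1}^{(N)}$ are the images under $\psi$ of $\mathsf W_{-k}^{(N)},\mathsf W_{k+1}^{(N)},\mathsf G_{k+1}^{(N)},\tilde{\mathsf G}_{k+1}^{(N)}$.
   Context: **Conventions.** $q\in\mathbb C^*$ is not a root of unity, $\mathbb N=\{0,1,\dots\}$, spins lie in $\frac12\mathbb N_+$, $\overline\ell=\ell\bmod2$, $[n]_q=\frac{q^n-q^{-n}}{q-q^{-1}}$, $[X,Y]_q=qXY-q^{-1}YX$, $c(u)=u-u^{-1}$. Fix $k_\pm\in\mathbb C^*$, $\varepsilon_\pm,\bar\varepsilon_\pm,\bar k_\pm\in\mathbb C$, $\rho=k_+k_-(q+q^{-1})^2$. **$\mathcal A_q$** is the unital associative algebra generated by $\mathsf W_{-k},\mathsf W_{k+1},\mathsf G_{k+1},\tilde{\mathsf G}_{k+1}$ ($k\in\mathbb N$) with, for $k,l\in\mathbb N$: $[\mathsf W_0,\mathsf W_{k+1}]=[\mathsf W_{-k},\mathsf W_1]=\frac{\tilde{\mathsf G}_{k+1}-\mathsf G_{k+1}}{q+q^{-1}}$; $[\mathsf W_0,\mathsf G_{k+1}]_q=[\tilde{\mathsf G}_{k+1},\mathsf W_0]_q=\rho(\mathsf W_{-k-1}-\mathsf W_{k+1})$; $[\mathsf G_{k+1},\mathsf W_1]_q=[\mathsf W_1,\tilde{\mathsf G}_{k+1}]_q=\rho(\mathsf W_{k+2}-\mathsf W_{-k})$; $[\mathsf W_{-k},\mathsf W_{-l}]=[\mathsf W_{k+1},\mathsf W_{l+1}]=[\mathsf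 G_{k+1},\mathsf G_{l+1}]=[\tilde{\mathsf G}_{k+1},\tilde{\mathsf G}_{l+1}]=0$; and $[X_k,Y_l]+[Y_k,X_l]=0$ for every pair $(X_k,Y_k)$ chosen from the families $\mathsf W_{-k},\mathsf W_{k+1},\mathsf G_{k+1},\tilde{\mathsf G}_{k+1}$. **$\mathcal A_q^{(N)}$** is the quotient of $\mathcal A_q$ by, for all $\ell\in\mathbb N$: $\sum_{k=0}^Nd_k^{(N)}\mathsf W_{-k-\ell}+\overline{\ell+1}\,\varepsilon_+^{(N)}+\overline\ell\,\varepsilon_-^{(N)}=0$, $\sum_{k=0}^Nd_k^{(N)}\mathsf W_{k+1+\ell}+\overline{\ell+1}\,\varepsilon_-^{(N)}+\overline\ell\,\varepsilon_+^{(N)}=0$, $\sum_{k=0}^Nd_k^{(N)}\mathsf G_{k+1+\ell}=0=\sum_{k=0}^Nd_k^{(N)}\tilde{\mathsf G}_{k+1+\ell}$; images of generators carry a superscript $(N)$. **Parameters.** $w_0^{(j)}=q^{2j+1}+q^{-2j-1}$; $\varepsilon_\pm^{(0)}=\varepsilon_\pm$, $\varepsilon_\pm^{(n)}=w_0^{(j_n)}\varepsilon_\mp^{(n-1)}-(v_n^2+v_n^{-2})\varepsilon_\pm^{(n-1)}$; $d_n^{(N)}=(-1)^{N+1-n}(q+q^{-1})^n\sum_{k_1<\dots<k_{N-n}}\alpha_{k_1}\cdots\alpha_{k_{N-n}}$ ($0\le n\le N$), with $\alpha_1=\frac{(v_1^2+v_1^{-2})w_0^{(j_1)}}{q+q^{-1}}+\frac{\varepsilon_+\varepsilon_-(q-q^{-1})^2}{k_+k_-(q+q^{-1})}$,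 $\alpha_n=\frac{(v_n^2+v_n^{-2})w_0^{(j_n)}}{q+q^{-1}}$ for $n\ge2$. **Series.** $U=\frac{qu^2+q^{-1}u^{-2}}{q+q^{-1}}$, $P_{-k}^{(N)}(u)=-\frac1{q+q^{-1}}\sum_{n=k}^{N-1}d_{n+1}^{(N)}U^{n-k}$, $h_0^{(N)}(u)=-\frac1{q+q^{-1}}\sum_{k=0}^Nd_k^{(N)}U^k$, $\mathsf W_+^{(N)}(u)=\sum_{k=0}^{N-1}P_{-k}^{(N)}(u)\mathsf W_{-k}^{(N)}$, $\mathsf W_-^{(N)}(u)=\sum P_{-k}^{(N)}(u)\mathsf W_{k+1}^{(N)}$, $\mathsf G_+^{(N)}(u)=\sum P_{-k}^{(N)}(u)\mathsf G_{k+1}^{(N)}$, $\mathsf G_-^{(N)}(u)=\sum P_{-k}^{(N)}(u)\tilde{\mathsf G}_{k+1}^{(N)}$; $\mathsf I^{(N)}(u)=\bar\varepsilon_+\mathsf W_+^{(N)}(u)+\bar\varepsilon_-\mathsf W_-^{(N)}(u)+\frac1{q^2-q^{-2}}\Big(\frac{\bar k_+}{k_+}\mathsf G_-^{(N)}(u)+\frac{\bar k_-}{k_-}\mathsf G_+^{(N)}(u)\Big)$; $\mathsf I_{2k+1}^{(N)}$ is the image in $\mathcal A_q^{(N)}$ of $\mathsf I_{2k+1}=\bar\varepsilon_+\mathsf W_{-k}+\bar\varepsilon_-\mathsf W_{k+1}+\frac1{q^2-q^{-2}}\Big(\frac{\bar k_-}{k_-}\mathsf G_{k+1}+\frac{\bar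 k_+}{k_+}\tilde{\mathsf G}_{k+1}\Big)$; $\mathsf I_0=\frac\rho{(q-q^{-1})(q^2-q^{-2})}\Big(\frac{\bar k_+}{k_+}+\frac{\bar k_-}{k_-}\Big)$. **Spin-chain representation.** $B_{j,j'}=\sqrt{[j+j']_q[j-j'+1]_q}$; spin-$j$ matrices $(S_+)_{mn}=B_{j,j+1-m}\delta_{m,n-1}$, $(S_-)_{mn}=B_{j,j+1-n}\delta_{m-1,n}$, $(S_3)_{mn}=2(j+1-n)\delta_{mn}$. $K^{(\frac12)}(u)=\begin{pmatrix}u\varepsilon_++u^{-1}\varepsilon_-&k_+c(u^2)/(q-q^{-1})\\k_-c(u^2)/(q-q^{-1})&u\varepsilon_-+u^{-1}\varepsilon_+\end{pmatrix}$, $L^{(j',\frac12)}(u)=\begin{pmatrix}uq^{\frac12}q^{S_3/2}-u^{-1}q^{-\frac12}q^{-S_3/2}&(q-q^{-1})S_-\\(q-q^{-1})S_+&uq^{\frac12}q^{-S_3/2}-u^{-1}q^{-\frac12}q^{S_3/2}\end{pmatrix}$ (spin-$j'$ entries). $\mathcal K^{(\frac12,N)}(u)=\begin{pmatrix}\mathcal A&\mathcal B\\\mathcal C&\mathcal D\end{pmatrix}$ with $\mathcal A=u\varepsilon_+^{(N)}+u^{-1}\varepsilon_-^{(N)}+c(u^2)(uq\mathsf W_+^{(N)}(u)-u^{-1}q^{-1}\mathsf W_-^{(N)}(u))$, $\mathcal D=u\varepsilon_-^{(N)}+u^{-1}\varepsilon_+^{(N)}+c(u^2)(uq\mathsf W_-^{(N)}(u)-u^{-1}q^{-1}\mathsf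 W_+^{(N)}(u))$, $\mathcal B=\frac{c(u^2)}{k_-}\Big(\frac{k_+k_-(u^2q+u^{-2}q^{-1})}{q-q^{-1}}P_0^{(N)}(u)+\frac{\mathsf G_+^{(N)}(u)}{q+q^{-1}}-\frac{k_+k_-d_0^{(N)}}{q-q^{-1}}\Big)$, $\mathcal C$ the same with $\frac1{k_-}\to\frac1{k_+}$, $\mathsf G_+^{(N)}\to\mathsf G_-^{(N)}$. $\psi^{(N)}_{\boldsymbol{\bar\jmath},\bar v}:\mathcal A_q^{(N)}\to\mathrm{End}(\mathbb C^{2j_N+1}\otimes\dots\otimes\mathbb C^{2j_1+1})$ is the algebra map defined by identification of entries in $(\psi\otimes\mathrm{id})(\mathcal K^{(\frac12,N)}(u))=L^{(j_N,\frac12)}_{[N]}(uv_N)\cdots L^{(j_1,\frac12)}_{[1]}(uv_1)K^{(\frac12)}(u)L^{(j_1,\frac12)}_{[1]}(uv_1^{-1})\cdots L^{(j_N,\frac12)}_{[N]}(uv_N^{-1})$ (known to be well defined), $[n]$ labelling the quantum space $\mathbb C^{2j_n+1}$. **Normalized spin-$\frac12$ transfer matrix.** $\tilde{\boldsymbol t}^{\frac12,\boldsymbol{\bar\jmath}}(u)=\mathrm{tr}_{\mathbb C^2}\big(K_a^{+(\frac12)}(u)\tilde R^{(j_N,\frac12)}_{Na}(uv_N)\cdots\tilde R^{(j_1,\frac12)}_{1a}(uv_1)K_a^{(\frac12)}(u)\tilde R^{(j_1,\frac12)}_{1a}(uv_1^{-1})\cdots\tilde R^{(j_N,\frac12)}_{Na}(uv_N^{-1})\big)$,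 where $K^{+(\frac12)}(u)=\big(K^{(\frac12)}(u^{-1}q^{-1})\big)^t$ with $\varepsilon_\pm\to\bar\varepsilon_\mp$, $k_\pm\to-\bar k_\mp$, $\tilde R^{(j_n,\frac12)}(u)=\Big(\prod_{k=0}^{2j_n-1}c(uq^{j_n+\frac12-k})\Big)^{-1}R^{(j_n,\frac12)}(u)$, and $R^{(j_n,\frac12)}$ (quantum space first, auxiliary space $a$ second) is obtained by exchanging the two tensor factors in $R^{(\frac12,j_n)}(u)=\prod_{k=0}^{2j_n-2}c(uq^{j_n-\frac12-k})\Big((q-q^{-1})(\sigma_+\otimes S_-+\sigma_-\otimes S_+)+uq^{\frac12(\mathbb I+\sigma_z\otimes S_3)}-u^{-1}q^{-\frac12(\mathbb I+\sigma_z\otimes S_3)}\Big)$. *)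

theory Defs
  imports
    "HOL-Library.Poly_Mapping"
    "HOL-Algebra.QuotRing"
    "HOL-Algebra.Algebraic_Closure_Type"
    "Jordan_Normal_Form.Matrix"
begin

section \<open>Parameters\<close>

text \<open>
  Half-integer powers of \<open>q\<close> are taken with respect to a fixed square root \<open>qhalf\<close> of \<open>q\<close>, so
  \<open>q\<^sup>x = qhalf powi (2 * x)\<close>. A spin \<open>j\<close> is recorded by the natural number \<open>2 * j\<close>: the field
  \<open>twospin\<close> is \<open>n \<mapsto> 2 * j\<^sub>n\<close>, and the quantum space at site \<open>n\<close> has dimension \<open>twospin n + 1\<close>.
  The sites are \<open>1, ..., sites\<close>; values of \<open>twospin\<close> and \<open>inhom\<close> (the parameters \<open>v\<^sub>n\<close>) at other
  arguments are never used.
\<close>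

record spin_chain =
  qpar :: complex
  qhalf :: complex
  k_plus :: complex
  k_minus :: complex
  eps_plus :: complex
  eps_minus :: complex
  kbar_plus :: complex
  kbar_minus :: complex
  epsbar_plus :: complex
  epsbar_minus :: complex
  sites :: nat
  twospin :: "nat \<Rightarrow> nat"
  inhom :: "nat \<Rightarrow> complex"

definition not_root_of_unity :: "complex \<Rightarrow> bool" where
  "not_root_of_unity q \<longleftrightarrow> (\<forall>n\<ge>1. q ^ n \<noteq> 1)"

definition valid_spin_chain :: "spin_chain \<Rightarrow> bool" where
  "valid_spin_chain P \<longleftrightarrow>
     qpar P \<noteq> 0 \<and> not_root_of_unity (qpar P) \<and> qhalf P ^ 2 = qpar P \<and>
     k_plus P \<noteq> 0 \<and> k_minus P \<noteq> 0 \<and>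
     (\<forall>n\<in>{1..sites P}. twospin P n \<ge> 1 \<and> inhom P n \<noteq> 0)"

definition cc :: "complex \<Rightarrow> complex" where
  "cc u = u - inverse u"

definition qnum :: "complex \<Rightarrow> int \<Rightarrow> complex" where
  "qnum q n = (q powi n - q powi (- n)) / (q - inverse q)"

definition rho :: "spin_chain \<Rightarrow> complex" where
  "rho P = k_plus P * k_minus P * (qpar P + inverse (qpar P)) ^ 2"

text \<open>\<open>w0 P n\<close> is \<open>w\<^sub>0\<close> for the spin \<open>j\<^sub>n\<close>.\<close>

definition w0 :: "spin_chain \<Rightarrow> nat \<Rightarrow> complex" where
  "w0 P n = qpar P ^ (twospin P n + 1) + inverse (qpar P ^ (twospin P n + 1))"

definition vsq :: "spin_chain \<Rightarrow> nat \<Rightarrow> complex" where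
  "vsq P n = inhom P n ^ 2 + inverse (inhom P n ^ 2)"

fun eps_plus_at and eps_minus_at :: "spin_chain \<Rightarrow> nat \<Rightarrow> complex" where
  "eps_plus_at P 0 = eps_plus P"
| "eps_plus_at P (Suc n) =
     w0 P (Suc n) * eps_minus_at P n - vsq P (Suc n) * eps_plus_at P n"
| "eps_minus_at P 0 = eps_minus P"
| "eps_minus_at P (Suc n) =
     w0 P (Suc n) * eps_plus_at P n - vsq P (Suc n) * eps_minus_at P n"

definition alpha :: "spin_chain \<Rightarrow> nat \<Rightarrow> complex" where
  "alpha P n = vsq P n * w0 P n / (qpar P + inverse (qpar P)) +
     (if n = 1 then eps_plus P * eps_minus P * (qpar P - inverse (qpar P)) ^ 2 /
                    (k_plus P * k_minus P * (qpar P + inverse (qpar P)))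
      else 0)"

definition dcoef :: "spin_chain \<Rightarrow> nat \<Rightarrow> complex" where
  "dcoef P n = (-1) ^ (sites P + 1 - n) * (qpar P + inverse (qpar P)) ^ n *
     (\<Sum>S\<in>{S. S \<subseteq> {1..sites P} \<and> card S = sites P - n}. \<Prod>k\<in>S. alpha P k)"

definition Uvar :: "spin_chain \<Rightarrow> complex \<Rightarrow> complex" where
  "Uvar P u = (qpar P * u ^ 2 + inverse (qpar P) * inverse (u ^ 2)) /
              (qpar P + inverse (qpar P))"

text \<open>\<open>Pfun P k u\<close> is the function with index \<open>-k\<close>.\<close>

definition Pfun :: "spin_chain \<Rightarrow> nat \<Rightarrow> complex \<Rightarrow> complex" where
  "Pfun P k u = - (1 / (qpar P + inverse (qpar P))) *
     (\<Sum>n\<in>{k..<sites P}. dcoef P (n + 1) * Uvar P u ^ (n - k))"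

definition h0 :: "spin_chain \<Rightarrow> complex \<Rightarrow> complex" where
  "h0 P u = - (1 / (qpar P + inverse (qpar P))) * (\<Sum>k\<in>{0..sites P}. dcoef P k * Uvar P u ^ k)"

definition I0 :: "spin_chain \<Rightarrow> complex" where
  "I0 P = rho P / ((qpar P - inverse (qpar P)) * (qpar P ^ 2 - inverse (qpar P ^ 2))) *
     (kbar_plus P / k_plus P + kbar_minus P / k_minus P)"


section \<open>The alternating algebra and its quotient\<close>

text \<open>
  \<open>Wm k\<close>, \<open>Wp k\<close>, \<open>Gg k\<close>, \<open>Gt k\<close> stand for the generators with indices \<open>-k\<close>, \<open>k+1\<close>, \<open>k+1\<close>, \<open>k+1\<close>:
  \<open>W\<close>, \<open>W\<close>, \<open>G\<close> and \<open>G\<close> with a tilde.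
\<close>

datatype gen = Wm nat | Wp nat | Gg nat | Gt nat

text \<open>
  The free unital algebra on the generators is the monoid algebra of the free monoid. As the
  product of \<open>Poly_Mapping\<close> is convolution over an additively written monoid, concatenation of
  words is written as addition; it is not commutative.
\<close>

datatype gword = Word (letters: "gen list")

instantiation gword :: monoid_add
begin

definition zero_gword :: gword where
  "zero_gword = Word []"

definition plus_gword :: "gword \<Rightarrow> gword \<Rightarrow> gword" where
  "plus_gword x y = Word (letters x @ letters y)"

instance
  by standard (simp_all add: zero_gword_def plus_gword_def)

end

type_synonym free_alg = "gword \<Rightarrow>\<^sub>0 complex"

definition fgen :: "gen \<Rightarrow> free_alg" where
  "fgen g = Poly_Mapping.single (Word [g]) 1"

definition fconst :: "complex \<Rightarrow> free_alg" where
  "fconst z = Poly_Mapping.single 0 z"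

definition comm :: "free_alg \<Rightarrow> free_alg \<Rightarrow> free_alg" where
  "comm x y = x * y - y * x"

definition qcomm :: "complex \<Rightarrow> free_alg \<Rightarrow> free_alg \<Rightarrow> free_alg" where
  "qcomm q x y = fconst q * x * y - fconst (inverse q) * y * x"

definition Aq_rels :: "complex \<Rightarrow> complex \<Rightarrow> free_alg set" where
  "Aq_rels q r =
     (\<Union>k. let D = fconst (1 / (q + inverse q)) * (fgen (Gt k) - fgen (Gg k));
              E = fconst r * (fgen (Wm (k + 1)) - fgen (Wp k));
              F = fconst r * (fgen (Wp (k + 1)) - fgen (Wm k))
          in {comm (fgen (Wm 0)) (fgen (Wp k)) - D,
              comm (fgen (Wm k)) (fgen (Wp 0)) - D,
              qcomm q (fgen (Wm 0)) (fgen (Gg k)) - E,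
              qcomm q (fgen (Gt k)) (fgen (Wm 0)) - E,
              qcomm q (fgen (Gg k)) (fgen (Wp 0)) - F,
              qcomm q (fgen (Wp 0)) (fgen (Gt k)) - F}) \<union>
     {comm (fgen (f k)) (fgen (f l)) | f k l. f \<in> {Wm, Wp, Gg, Gt}} \<union>
     {comm (fgen (f k)) (fgen (g l)) + comm (fgen (g k)) (fgen (f l)) | f g k l.
        f \<in> {Wm, Wp, Gg, Gt} \<and> g \<in> {Wm, Wp, Gg, Gt}}"

abbreviation Fring :: "free_alg ring" where
  "Fring \<equiv> ring_of_type_algebra"

definition Aq_ideal :: "spin_chain \<Rightarrow> free_alg set" where
  "Aq_ideal P = genideal Fring (Aq_rels (qpar P) (rho P))"

definition Aq :: "spin_chain \<Rightarrow> free_alg set ring" where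
  "Aq P = Fring Quot Aq_ideal P"

definition Aq_class :: "spin_chain \<Rightarrow> free_alg \<Rightarrow> free_alg set" where
  "Aq_class P x = Aq_ideal P +>\<^bsub>Fring\<^esub> x"

definition Aq_gen :: "spin_chain \<Rightarrow> gen \<Rightarrow> free_alg set" where
  "Aq_gen P g = Aq_class P (fgen g)"

definition Aq_const :: "spin_chain \<Rightarrow> complex \<Rightarrow> free_alg set" where
  "Aq_const P z = Aq_class P (fconst z)"

definition Aq_smult :: "spin_chain \<Rightarrow> complex \<Rightarrow> free_alg set \<Rightarrow> free_alg set" where
  "Aq_smult P z x = Aq_const P z \<otimes>\<^bsub>Aq P\<^esub> x"

definition AqN_rels :: "spin_chain \<Rightarrow> free_alg set set" where
  "AqN_rels P =
     (let N = sites P;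
          par = (\<lambda>l. of_nat (l mod 2) :: complex);
          lin = (\<lambda>f l. \<Oplus>\<^bsub>Aq P\<^esub>k\<in>{0..N}. Aq_smult P (dcoef P k) (Aq_gen P (f (k + l))))
      in \<Union>l.
        {lin Wm l \<oplus>\<^bsub>Aq P\<^esub> Aq_const P (par (l + 1) * eps_plus_at P N + par l * eps_minus_at P N),
         lin Wp l \<oplus>\<^bsub>Aq P\<^esub> Aq_const P (par (l + 1) * eps_minus_at P N + par l * eps_plus_at P N),
         lin Gg l,
         lin Gt l})"

definition AqN_ideal :: "spin_chain \<Rightarrow> free_alg set set" where
  "AqN_ideal P = genideal (Aq P) (AqN_rels P)"

definition AqN :: "spin_chain \<Rightarrow> free_alg set set ring" where
  "AqN P = Aq P Quot AqN_ideal P"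

definition AqN_class :: "spin_chain \<Rightarrow> free_alg set \<Rightarrow> free_alg set set" where
  "AqN_class P x = AqN_ideal P +>\<^bsub>Aq P\<^esub> x"

definition AqN_gen :: "spin_chain \<Rightarrow> gen \<Rightarrow> free_alg set set" where
  "AqN_gen P g = AqN_class P (Aq_gen P g)"

definition AqN_const :: "spin_chain \<Rightarrow> complex \<Rightarrow> free_alg set set" where
  "AqN_const P z = AqN_class P (Aq_const P z)"

definition AqN_smult :: "spin_chain \<Rightarrow> complex \<Rightarrow> free_alg set set \<Rightarrow> free_alg set set" where
  "AqN_smult P z x = AqN_const P z \<otimes>\<^bsub>AqN P\<^esub> x"

text \<open>
  The four generating functions \<open>W\<^sub>+(u)\<close>, \<open>W\<^sub>-(u)\<close>, \<open>G\<^sub>+(u)\<close>, \<open>G\<^sub>-(u)\<close> are \<open>gser P f u\<close> with \<open>f\<close> one of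
  \<open>Wm\<close>, \<open>Wp\<close>, \<open>Gg\<close>, \<open>Gt\<close>, in this order.
\<close>

definition gser :: "spin_chain \<Rightarrow> (nat \<Rightarrow> gen) \<Rightarrow> complex \<Rightarrow> free_alg set set" where
  "gser P f u = (\<Oplus>\<^bsub>AqN P\<^esub>k\<in>{0..<sites P}. AqN_smult P (Pfun P k u) (AqN_gen P (f k)))"

definition Iser :: "spin_chain \<Rightarrow> complex \<Rightarrow> free_alg set set" where
  "Iser P u =
     AqN_smult P (epsbar_plus P) (gser P Wm u) \<oplus>\<^bsub>AqN P\<^esub>
     AqN_smult P (epsbar_minus P) (gser P Wp u) \<oplus>\<^bsub>AqN P\<^esub>
     AqN_smult P (1 / (qpar P ^ 2 - inverse (qpar P ^ 2)))
       (AqN_smult P (kbar_plus P / k_plus P) (gser P Gt u) \<oplus>\<^bsub>AqN P\<^esub>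
        AqN_smult P (kbar_minus P / k_minus P) (gser P Gg u))"

text \<open>\<open>Iodd P k\<close> and \<open>IoddN P k\<close> are the element with index \<open>2k+1\<close> and its image in the quotient.\<close>

definition Iodd :: "spin_chain \<Rightarrow> nat \<Rightarrow> free_alg set" where
  "Iodd P k =
     Aq_smult P (epsbar_plus P) (Aq_gen P (Wm k)) \<oplus>\<^bsub>Aq P\<^esub>
     Aq_smult P (epsbar_minus P) (Aq_gen P (Wp k)) \<oplus>\<^bsub>Aq P\<^esub>
     Aq_smult P (1 / (qpar P ^ 2 - inverse (qpar P ^ 2)))
       (Aq_smult P (kbar_minus P / k_minus P) (Aq_gen P (Gg k)) \<oplus>\<^bsub>Aq P\<^esub>
        Aq_smult P (kbar_plus P / k_plus P) (Aq_gen P (Gt k)))"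

definition IoddN :: "spin_chain \<Rightarrow> nat \<Rightarrow> free_alg set set" where
  "IoddN P k = AqN_class P (Iodd P k)"

text \<open>
  Entries of the spin-1/2 K-operator over the quotient algebra. The two diagonal entries are
  \<open>Kdiag P ep em Wm Wp u\<close> and \<open>Kdiag P em ep Wp Wm u\<close>; the off-diagonal ones are \<open>Koff\<close> with the
  prefactor \<open>k\<^sub>-\<close> and \<open>Gg\<close> (upper right), respectively \<open>k\<^sub>+\<close> and \<open>Gt\<close> (lower left).
\<close>

definition Kdiag ::
  "spin_chain \<Rightarrow> complex \<Rightarrow> complex \<Rightarrow> (nat \<Rightarrow> gen) \<Rightarrow> (nat \<Rightarrow> gen) \<Rightarrow> complex \<Rightarrow> free_alg set set" where
  "Kdiag P e1 e2 f g u =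
     AqN_const P (u * e1 + inverse u * e2) \<oplus>\<^bsub>AqN P\<^esub>
     AqN_smult P (cc (u ^ 2))
       (AqN_smult P (u * qpar P) (gser P f u) \<ominus>\<^bsub>AqN P\<^esub>
        AqN_smult P (inverse u * inverse (qpar P)) (gser P g u))"

definition Koff :: "spin_chain \<Rightarrow> complex \<Rightarrow> (nat \<Rightarrow> gen) \<Rightarrow> complex \<Rightarrow> free_alg set set" where
  "Koff P k f u =
     AqN_smult P (cc (u ^ 2) / k)
       (AqN_const P (k_plus P * k_minus P * (u ^ 2 * qpar P + inverse (u ^ 2) * inverse (qpar P)) /
                     (qpar P - inverse (qpar P)) * Pfun P 0 u) \<oplus>\<^bsub>AqN P\<^esub>
        AqN_smult P (1 / (qpar P + inverse (qpar P))) (gser P f u) \<ominus>\<^bsub>AqN P\<^esub>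
        AqN_const P (k_plus P * k_minus P * dcoef P 0 / (qpar P - inverse (qpar P))))"

definition KopA :: "spin_chain \<Rightarrow> complex \<Rightarrow> free_alg set set" where
  "KopA P u = Kdiag P (eps_plus_at P (sites P)) (eps_minus_at P (sites P)) Wm Wp u"

definition KopB :: "spin_chain \<Rightarrow> complex \<Rightarrow> free_alg set set" where
  "KopB P u = Koff P (k_minus P) Gg u"

definition KopC :: "spin_chain \<Rightarrow> complex \<Rightarrow> free_alg set set" where
  "KopC P u = Koff P (k_plus P) Gt u"

definition KopD :: "spin_chain \<Rightarrow> complex \<Rightarrow> free_alg set set" where
  "KopD P u = Kdiag P (eps_minus_at P (sites P)) (eps_plus_at P (sites P)) Wp Wm u"


section \<open>Operators on the spin chain\<close>

definition kron :: "'a::semiring_0 mat \<Rightarrow> 'a mat \<Rightarrow> 'a mat" where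
  "kron A B = mat (dim_row A * dim_row B) (dim_col A * dim_col B)
     (\<lambda>(r, s). A $$ (r div dim_row B, s div dim_col B) * B $$ (r mod dim_row B, s mod dim_col B))"

text \<open>
  An operator on \<open>V \<otimes> \<complex>\<^sup>2\<close>, with the auxiliary space as the second factor, is a matrix whose row and
  column indices are \<open>2 * i + a\<close>, where \<open>i\<close> indexes \<open>V\<close> and \<open>a\<close> is 0 or 1. \<open>aux_block\<close> extracts
  the entry in position \<open>(a, b)\<close> of the corresponding \<open>2 \<times> 2\<close> matrix over \<open>End V\<close>; \<open>aux_op\<close> assembles
  an operator from its four entries.
\<close>

definition aux_op :: "nat \<Rightarrow> complex mat \<Rightarrow> complex mat \<Rightarrow> complex mat \<Rightarrow> complex mat \<Rightarrow> complex mat" where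
  "aux_op d A B C D = mat (2 * d) (2 * d)
     (\<lambda>(r, s). (if r mod 2 = 0 then (if s mod 2 = 0 then A else B)
                else (if s mod 2 = 0 then C else D)) $$ (r div 2, s div 2))"

definition aux_block :: "complex mat \<Rightarrow> nat \<Rightarrow> nat \<Rightarrow> complex mat" where
  "aux_block M a b = mat (dim_row M div 2) (dim_col M div 2) (\<lambda>(i, k). M $$ (2 * i + a, 2 * k + b))"

definition aux_trace :: "complex mat \<Rightarrow> complex mat" where
  "aux_trace M = aux_block M 0 0 + aux_block M 1 1"

text \<open>
  Spin matrices for \<open>t = 2 * j\<close>, with rows and columns counted from 0 instead of 1.
  \<open>Bcoef q t m\<close> is the number \<open>B\<close> with indices \<open>j\<close> and \<open>j + 1 - m\<close>, so the two factors under
  the root are \<open>[2j + 1 - m]\<close> and \<open>[m]\<close>.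
  \<open>S3\<close> is an integer matrix, which makes \<open>q\<close> to the power \<open>S3 / 2\<close> an integer power of \<open>qhalf\<close>;
  \<open>qexp s M\<close> is \<open>s\<close> to the power \<open>M\<close> for a diagonal matrix \<open>M\<close>.
\<close>

definition Bcoef :: "complex \<Rightarrow> nat \<Rightarrow> nat \<Rightarrow> complex" where
  "Bcoef q t m = csqrt (qnum q (int t + 1 - int m) * qnum q (int m))"

definition S_plus :: "complex \<Rightarrow> nat \<Rightarrow> complex mat" where
  "S_plus q t = mat (t + 1) (t + 1) (\<lambda>(m, n). if n = m + 1 then Bcoef q t (m + 1) else 0)"

definition S_minus :: "complex \<Rightarrow> nat \<Rightarrow> complex mat" where
  "S_minus q t = mat (t + 1) (t + 1) (\<lambda>(m, n). if m = n + 1 then Bcoef q t (n + 1) else 0)"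

definition S3 :: "nat \<Rightarrow> int mat" where
  "S3 t = mat (t + 1) (t + 1) (\<lambda>(m, n). if m = n then int t - 2 * int n else 0)"

definition qexp :: "complex \<Rightarrow> int mat \<Rightarrow> complex mat" where
  "qexp s M = mat (dim_row M) (dim_col M) (\<lambda>(i, k). if i = k then s powi (M $$ (i, i)) else 0)"

definition sigma_plus :: "complex mat" where
  "sigma_plus = mat_of_rows_list 2 [[0, 1], [0, 0]]"

definition sigma_minus :: "complex mat" where
  "sigma_minus = mat_of_rows_list 2 [[0, 0], [1, 0]]"

definition sigma_z :: "int mat" where
  "sigma_z = mat_of_rows_list 2 [[1, 0], [0, - 1]]"

definition Lop :: "complex \<Rightarrow> nat \<Rightarrow> complex \<Rightarrow> complex mat" where
  "Lop s t u = (let q = s ^ 2 in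
     aux_op (t + 1)
       ((u * s) \<cdot>\<^sub>m qexp s (S3 t) - (inverse u * inverse s) \<cdot>\<^sub>m qexp s (- S3 t))
       ((q - inverse q) \<cdot>\<^sub>m S_minus q t)
       ((q - inverse q) \<cdot>\<^sub>m S_plus q t)
       ((u * s) \<cdot>\<^sub>m qexp s (- S3 t) - (inverse u * inverse s) \<cdot>\<^sub>m qexp s (S3 t)))"

definition R_half :: "complex \<Rightarrow> nat \<Rightarrow> complex \<Rightarrow> complex mat" where
  "R_half s t u = (let q = s ^ 2; E = 1\<^sub>m (2 * (t + 1)) + kron sigma_z (S3 t) in
     (\<Prod>k<t - 1. cc (u * s powi (int t - 1 - 2 * int k))) \<cdot>\<^sub>m
       ((q - inverse q) \<cdot>\<^sub>m (kron sigma_plus (S_minus q t) + kron sigma_minus (S_plus q t)) +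
        u \<cdot>\<^sub>m qexp s E - inverse u \<cdot>\<^sub>m qexp s (- E)))"

text \<open>\<open>R_flip\<close> acts on \<open>\<complex>\<^bsup>2j+1\<^esup> \<otimes> \<complex>\<^sup>2\<close> and arises from \<open>R_half\<close> by exchanging the tensor factors.\<close>

definition R_flip :: "complex \<Rightarrow> nat \<Rightarrow> complex \<Rightarrow> complex mat" where
  "R_flip s t u = mat (2 * (t + 1)) (2 * (t + 1))
     (\<lambda>(r, l). R_half s t u $$ ((r mod 2) * (t + 1) + r div 2, (l mod 2) * (t + 1) + l div 2))"

definition R_norm_factor :: "complex \<Rightarrow> nat \<Rightarrow> nat \<Rightarrow> complex \<Rightarrow> complex" where
  "R_norm_factor s t k u = cc (u * s powi (int t + 1 - 2 * int k))"

definition R_tilde :: "complex \<Rightarrow> nat \<Rightarrow> complex \<Rightarrow> complex mat" where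
  "R_tilde s t u = inverse (\<Prod>k<t. R_norm_factor s t k u) \<cdot>\<^sub>m R_flip s t u"

definition Kmat ::
  "complex \<Rightarrow> complex \<Rightarrow> complex \<Rightarrow> complex \<Rightarrow> complex \<Rightarrow> complex \<Rightarrow> complex mat" where
  "Kmat q ep em kp km u = mat_of_rows_list 2
     [[u * ep + inverse u * em, kp * cc (u ^ 2) / (q - inverse q)],
      [km * cc (u ^ 2) / (q - inverse q), u * em + inverse u * ep]]"

definition K_minus :: "spin_chain \<Rightarrow> complex \<Rightarrow> complex mat" where
  "K_minus P u = Kmat (qpar P) (eps_plus P) (eps_minus P) (k_plus P) (k_minus P) u"

definition K_plus :: "spin_chain \<Rightarrow> complex \<Rightarrow> complex mat" where
  "K_plus P u = transpose_mat (Kmat (qpar P) (epsbar_minus P) (epsbar_plus P)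
     (- kbar_minus P) (- kbar_plus P) (inverse u * inverse (qpar P)))"

definition qdim :: "spin_chain \<Rightarrow> nat" where
  "qdim P = (\<Prod>n\<in>{1..sites P}. twospin P n + 1)"

text \<open>The tensor factors of the quantum space are ordered with site \<open>N\<close> first and site 1 last.\<close>

definition site_op :: "spin_chain \<Rightarrow> nat \<Rightarrow> complex mat \<Rightarrow> complex mat" where
  "site_op P n x =
     kron (kron (1\<^sub>m (\<Prod>m\<in>{n + 1..sites P}. twospin P m + 1)) x)
          (1\<^sub>m (\<Prod>m\<in>{1..<n}. twospin P m + 1))"

text \<open>Embedding of an operator on the \<open>n\<close>-th quantum space tensored with the auxiliary space.\<close>

definition site_aux_op :: "spin_chain \<Rightarrow> nat \<Rightarrow> complex mat \<Rightarrow> complex mat" where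
  "site_aux_op P n M = aux_op (qdim P)
     (site_op P n (aux_block M 0 0)) (site_op P n (aux_block M 0 1))
     (site_op P n (aux_block M 1 0)) (site_op P n (aux_block M 1 1))"

definition aux_only :: "spin_chain \<Rightarrow> complex mat \<Rightarrow> complex mat" where
  "aux_only P K = kron (1\<^sub>m (qdim P)) K"

text \<open>\<open>dressed A B K n = A\<^sub>n \<cdots> A\<^sub>1 K B\<^sub>1 \<cdots> B\<^sub>n\<close>\<close>

primrec dressed ::
  "(nat \<Rightarrow> complex mat) \<Rightarrow> (nat \<Rightarrow> complex mat) \<Rightarrow> complex mat \<Rightarrow> nat \<Rightarrow> complex mat" where
  "dressed A B K 0 = K"
| "dressed A B K (Suc n) = A (Suc n) * dressed A B K n * B (Suc n)"

definition dressed_K :: "spin_chain \<Rightarrow> complex \<Rightarrow> complex mat" where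
  "dressed_K P u = dressed
     (\<lambda>n. site_aux_op P n (Lop (qhalf P) (twospin P n) (u * inhom P n)))
     (\<lambda>n. site_aux_op P n (Lop (qhalf P) (twospin P n) (u * inverse (inhom P n))))
     (aux_only P (K_minus P u)) (sites P)"

definition transfer_matrix :: "spin_chain \<Rightarrow> complex \<Rightarrow> complex mat" where
  "transfer_matrix P u = aux_trace (aux_only P (K_plus P u) * dressed
     (\<lambda>n. site_aux_op P n (R_tilde (qhalf P) (twospin P n) (u * inhom P n)))
     (\<lambda>n. site_aux_op P n (R_tilde (qhalf P) (twospin P n) (u * inverse (inhom P n))))
     (aux_only P (K_minus P u)) (sites P))"

abbreviation chain_End :: "spin_chain \<Rightarrow> complex mat ring" where
  "chain_End P \<equiv> ring_mat TYPE(complex) (qdim P) ()"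

text \<open>
  The unital \<open>\<complex>\<close>-algebra homomorphisms \<open>\<psi>\<close> from \<open>AqN P\<close> to the endomorphisms of the quantum space
  that send the entries of the K-operator to the entries of the dressed K-matrix. There is exactly
  one such \<open>\<psi>\<close> on the carrier of \<open>AqN P\<close>.
\<close>

definition spin_chain_rep :: "spin_chain \<Rightarrow> (free_alg set set \<Rightarrow> complex mat) \<Rightarrow> bool" where
  "spin_chain_rep P \<psi> \<longleftrightarrow>
     \<psi> \<in> Ring.ring_hom (AqN P) (chain_End P) \<and>
     (\<forall>z. \<forall>x\<in>carrier (AqN P). \<psi> (AqN_smult P z x) = z \<cdot>\<^sub>m \<psi> x) \<and>
     (\<forall>u. u \<noteq> 0 \<longrightarrow>
        aux_op (qdim P) (\<psi> (KopA P u)) (\<psi> (KopB P u)) (\<psi> (KopC P u)) (\<psi> (KopD P u)) =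
        dressed_K P u)"

text \<open>
  The transfer matrix is a rational function of \<open>u\<close>; \<open>regular_point P u\<close> says that none of the
  factors inverted in the normalised R-matrices occurring in it vanishes at \<open>u\<close>.
\<close>

definition regular_point :: "spin_chain \<Rightarrow> complex \<Rightarrow> bool" where
  "regular_point P u \<longleftrightarrow> u \<noteq> 0 \<and>
     (\<forall>n\<in>{1..sites P}. \<forall>k<twospin P n.
        R_norm_factor (qhalf P) (twospin P n) k (u * inhom P n) \<noteq> 0 \<and>
        R_norm_factor (qhalf P) (twospin P n) k (u * inverse (inhom P n)) \<noteq> 0)"

end

theory Submission
  imports Defs
begin

text \<open>
  Up to a scalar, the normalised R-matrix with a two-dimensional auxiliary space is the L-operator:
  the scalar prefactor of the R-matrix cancels all but one factor of its normalisation
  (\<open>R_tilde_eq_Lop\<close>). The scalars can be pulled out of the dressing and of the trace, so the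
  normalised transfer matrix is an explicit scalar multiple of the partial trace of
  \<open>(1 \<otimes> K\<^sup>+(u)) X(u)\<close>, where \<open>X(u)\<close> is the K-matrix dressed by L-operators
  (\<open>transfer_matrix_dressed_K\<close>).

  By definition, \<open>\<psi>\<close> sends the entries of the K-operator over the quotient algebra to the entries of
  \<open>X(u)\<close>, and the partial trace is the combination of these four entries with the entries of the
  scalar matrix \<open>K\<^sup>+(u)\<close> as coefficients (\<open>aux_trace_aux_op\<close>). As \<open>\<psi>\<close> is linear,
  everything reduces to comparing the coefficients of the identity and of the four generating
  functions. The two diagonal entries give the terms in \<open>W\<^sub>+(u)\<close>, \<open>W\<^sub>-(u)\<close> and the explicit scalar
  term (\<open>diagonal_contribution\<close>); the two off-diagonal entries give the terms in \<open>G\<^sub>+(u)\<close>,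
  \<open>G\<^sub>-(u)\<close> and, by the relation between \<open>h\<^sub>0\<close> and \<open>P\<^sub>0\<close> in \<open>h0_eq\<close>, the term
  \<open>h\<^sub>0(u) I\<^sub>0\<close> (\<open>offdiagonal_contribution\<close>). The statements on the expansion of \<open>I(u)\<close>
  hold because \<open>\<psi>\<close> and the projections onto the two quotients are linear.
\<close>

section \<open>R-matrices and L-operators\<close>

lemma smult_smult_mat: "a \<cdot>\<^sub>m (b \<cdot>\<^sub>m M) = (a * b) \<cdot>\<^sub>m M" for a :: "'a::semigroup_mult"
  by (rule eq_matI) (simp_all add: mult.assoc)

lemma kron_index:
  assumes "a < dim_row A" "i < dim_row B" "b < dim_col A" "k < dim_col B"
  shows "kron A B $$ (a * dim_row B + i, b * dim_col B + k) = A $$ (a, b) * B $$ (i, k)"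
proof -
  have "a * dim_row B + i < dim_row A * dim_row B" "b * dim_col B + k < dim_col A * dim_col B"
    using assms mult_le_mono1[of "Suc a" "dim_row A" "dim_row B"] mult_le_mono1[of "Suc b" "dim_col A" "dim_col B"]
    by auto
  then show ?thesis
    using assms by (simp add: kron_def div_add1_eq)
qed

lemma kron_dim [simp]:
  "dim_row (kron A B) = dim_row A * dim_row B" "dim_col (kron A B) = dim_col A * dim_col B"
  by (simp_all add: kron_def)

lemma sigma_dim [simp]:
  "dim_row sigma_plus = 2" "dim_col sigma_plus = 2" "dim_row sigma_minus = 2" "dim_col sigma_minus = 2"
  "dim_row sigma_z = 2" "dim_col sigma_z = 2"
  by (simp_all add: sigma_plus_def sigma_minus_def sigma_z_def mat_of_rows_list_def)

lemma spin_dim [simp]: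
  "dim_row (S_plus q t) = t + 1" "dim_col (S_plus q t) = t + 1"
  "dim_row (S_minus q t) = t + 1" "dim_col (S_minus q t) = t + 1"
  "dim_row (S3 t) = t + 1" "dim_col (S3 t) = t + 1"
  by (simp_all add: S_plus_def S_minus_def S3_def)

lemma qexp_dim [simp]: "dim_row (qexp s M) = dim_row M" "dim_col (qexp s M) = dim_col M"
  by (simp_all add: qexp_def)

text \<open>After the exchange of the tensor factors, the row \<open>2 * i + a\<close> of the flipped matrix is the row
  \<open>a * (t + 1) + i\<close> of \<open>R_half\<close>; the entries are compared for each pair of auxiliary indices.\<close>

lemma R_flip_eq_Lop:
  assumes "s \<noteq> 0"
  shows "R_flip s t u = (\<Prod>k<t - 1. cc (u * s powi (int t - 1 - 2 * int k))) \<cdot>\<^sub>m Lop s t u"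
proof (rule eq_matI)
  fix r l
  assume "r < dim_row ((\<Prod>k<t - 1. cc (u * s powi (int t - 1 - 2 * int k))) \<cdot>\<^sub>m Lop s t u)"
    and "l < dim_col ((\<Prod>k<t - 1. cc (u * s powi (int t - 1 - 2 * int k))) \<cdot>\<^sub>m Lop s t u)"
  then have rl: "r < 2 * (t + 1)" "l < 2 * (t + 1)"
    by (simp_all add: Lop_def Let_def aux_op_def)
  define a i b k where ab: "a = r mod 2" "i = r div 2" "b = l mod 2" "k = l div 2"
  have a: "a = 0 \<or> a = 1" and b: "b = 0 \<or> b = 1" and i: "i < t + 1" and k: "k < t + 1"
    using rl by (auto simp: ab)
  have pos: "a * (t + 1) + i < 2 * (t + 1)" "b * (t + 1) + k < 2 * (t + 1)"
    using a b i k by auto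
  let ?I = "a * (t + 1) + i" and ?J = "b * (t + 1) + k"
  have IJ: "?I = ?J \<longleftrightarrow> a = b \<and> i = k"
    using a b i k by auto
  let ?E = "1\<^sub>m (2 * (t + 1)) + kron sigma_z (S3 t)"
  have E: "?E $$ (?I, ?I) = 1 + sigma_z $$ (a, a) * (int t - 2 * int i)"
    using kron_index[of a sigma_z i "S3 t" a i] a i pos(1) by (auto simp: S3_def)
  have qE: "qexp s ?E $$ (?I, ?J) = (if a = b \<and> i = k then s powi (1 + sigma_z $$ (a, a) * (int t - 2 * int i)) else 0)"
    "qexp s (- ?E) $$ (?I, ?J) = (if a = b \<and> i = k then s powi (- (1 + sigma_z $$ (a, a) * (int t - 2 * int i))) else 0)"
    unfolding E[symmetric] IJ[symmetric] using pos by (simp_all add: qexp_def)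
  have K: "kron sigma_plus (S_minus q t) $$ (?I, ?J) = sigma_plus $$ (a, b) * S_minus q t $$ (i, k)"
    "kron sigma_minus (S_plus q t) $$ (?I, ?J) = sigma_minus $$ (a, b) * S_plus q t $$ (i, k)" for q
    using kron_index[of a sigma_plus i "S_minus q t" b k] kron_index[of a sigma_minus i "S_plus q t" b k] a b i k by auto
  have "R_half s t u $$ (?I, ?J) = (\<Prod>k<t - 1. cc (u * s powi (int t - 1 - 2 * int k))) *
      ((s ^ 2 - inverse (s ^ 2)) * (sigma_plus $$ (a, b) * S_minus (s ^ 2) t $$ (i, k) +
         sigma_minus $$ (a, b) * S_plus (s ^ 2) t $$ (i, k)) +
       u * qexp s ?E $$ (?I, ?J) - inverse u * qexp s (- ?E) $$ (?I, ?J))"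
    unfolding R_half_def Let_def K[symmetric] using pos by simp
  also have "\<dots> = (\<Prod>k<t - 1. cc (u * s powi (int t - 1 - 2 * int k))) * Lop s t u $$ (r, l)"
  proof -
    \<comment> \<open>\<open>x\<close> is the eigenvalue of \<open>S3\<close>; the exponents \<open>1 \<plusminus> x\<close> split off the powers of
      \<open>q\<close> to the one half that appear explicitly in the L-operator.\<close>
    define x where "x = int t - 2 * int i"
    have sx: "s powi (1 + x) = s * s powi x" "s powi (- (1 + x)) = inverse s * s powi (- x)"
      "s powi (1 + - x) = s * s powi (- x)" "s powi (- (1 + - x)) = inverse s * s powi x"
      using assms power_int_add[of s 1 x] power_int_add[of s "-1" "-x"]
        power_int_add[of s 1 "-x"] power_int_add[of s "-1" x] by (simp_all add: power_int_minus)
    have q: "qexp s (S3 t) $$ (i, k) = (if i = k then s powi x else 0)"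
      "qexp s (- S3 t) $$ (i, k) = (if i = k then s powi (- x) else 0)"
      using i k by (auto simp: qexp_def S3_def x_def)
    have sigma: "sigma_z $$ (0, 0) = 1" "sigma_z $$ (1, 1) = - 1"
      "sigma_plus $$ (0, 0) = 0" "sigma_plus $$ (0, 1) = 1" "sigma_plus $$ (1, 0) = 0" "sigma_plus $$ (1, 1) = 0"
      "sigma_minus $$ (0, 0) = 0" "sigma_minus $$ (0, 1) = 0" "sigma_minus $$ (1, 0) = 1" "sigma_minus $$ (1, 1) = 0"
      by (simp_all add: sigma_z_def sigma_plus_def sigma_minus_def mat_of_rows_list_def)
    have L: "Lop s t u $$ (r, l) = (if a = 0
      then if b = 0 then u * s * qexp s (S3 t) $$ (i, k) - inverse u * inverse s * qexp s (- S3 t) $$ (i, k)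
           else (s ^ 2 - inverse (s ^ 2)) * S_minus (s ^ 2) t $$ (i, k)
      else if b = 0 then (s ^ 2 - inverse (s ^ 2)) * S_plus (s ^ 2) t $$ (i, k)
           else u * s * qexp s (- S3 t) $$ (i, k) - inverse u * inverse s * qexp s (S3 t) $$ (i, k))"
      using rl i k by (simp add: Lop_def Let_def aux_op_def ab[symmetric])
    have sx': "s powi (1 + 1 * x) = s * s powi x" "s powi (- (1 + 1 * x)) = inverse s * s powi (- x)"
      "s powi (1 + - 1 * x) = s * s powi (- x)" "s powi (- (1 + - 1 * x)) = inverse s * s powi x"
      using sx by simp_all
    show ?thesis
      using a b unfolding qE L q x_def[symmetric] by (elim disjE) (simp_all only: sigma sx', simp_all)
  qed
  finally have "R_half s t u $$ (?I, ?J) =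
      (\<Prod>k<t - 1. cc (u * s powi (int t - 1 - 2 * int k))) * Lop s t u $$ (r, l)" .
  then show "R_flip s t u $$ (r, l) =
      ((\<Prod>k<t - 1. cc (u * s powi (int t - 1 - 2 * int k))) \<cdot>\<^sub>m Lop s t u) $$ (r, l)"
    using rl by (simp add: R_flip_def ab Lop_def Let_def aux_op_def)
qed (simp_all add: R_flip_def Lop_def Let_def aux_op_def)

text \<open>The factor with index \<open>k + 1\<close> of the normalisation is the factor with index \<open>k\<close> of the scalar
  prefactor of the R-matrix, so that only the factor with index 0 is left. The assumption \<open>t \<ge> 1\<close>
  excludes spin 0, where the normalisation is an empty product.\<close>

lemma R_tilde_eq_Lop:
  assumes "s \<noteq> 0" "t \<ge> 1" "\<And>k. k < t \<Longrightarrow> R_norm_factor s t k u \<noteq> 0"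
  shows "R_tilde s t u = inverse (cc (u * s ^ (t + 1))) \<cdot>\<^sub>m Lop s t u"
proof -
  obtain t' where t: "t = Suc t'" using assms(2) by (cases t) auto
  have zero: "R_norm_factor s t 0 u = cc (u * s ^ (t + 1))"
    using power_int_of_nat[of s "t + 1"] by (simp add: R_norm_factor_def add.commute)
  have Suc: "R_norm_factor s t (Suc k) u = cc (u * s powi (int t - 1 - 2 * int k))" for k
    unfolding R_norm_factor_def
    by (rule arg_cong[of _ _ "\<lambda>n. cc (u * s powi n)"]) simp
  have eq: "(\<Prod>k<t. R_norm_factor s t k u) =
     cc (u * s ^ (t + 1)) * (\<Prod>k<t - 1. cc (u * s powi (int t - 1 - 2 * int k)))"
    using prod.lessThan_Suc_shift[of "\<lambda>k. R_norm_factor s t k u" t'] zero Suc by (simp add: t)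
  have "(\<Prod>k<t. R_norm_factor s t k u) \<noteq> 0" using assms(3) by simp
  then show ?thesis
    unfolding R_tilde_def R_flip_eq_Lop[OF assms(1)] eq smult_smult_mat
    by (intro arg_cong2[of _ _ _ _ smult_mat]) (simp_all add: field_simps)
qed

section \<open>Dressing and traces\<close>

lemma site_op_dim:
  assumes "n \<in> {1..sites P}" "x \<in> carrier_mat (twospin P n + 1) (twospin P n + 1)"
  shows "site_op P n x \<in> carrier_mat (qdim P) (qdim P)"
proof -
  have "{1..sites P} = {n + 1..sites P} \<union> insert n {1..<n}" using assms(1) by auto
  then have "qdim P = (\<Prod>m\<in>{n + 1..sites P} \<union> insert n {1..<n}. twospin P m + 1)"
    by (simp add: qdim_def)
  also have "\<dots> = (\<Prod>m\<in>{n + 1..sites P}. twospin P m + 1) * (\<Prod>m\<in>insert n {1..<n}. twospin P m + 1)"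
    by (rule prod.union_disjoint) auto
  finally show ?thesis using assms(2) by (intro carrier_matI) (simp_all add: site_op_def algebra_simps)
qed

lemma kron_smult: "kron (c \<cdot>\<^sub>m A) B = c \<cdot>\<^sub>m kron A B" "kron A (c \<cdot>\<^sub>m B) = c \<cdot>\<^sub>m kron A B"
  for c :: complex
proof -
  have [simp]: "r < x * y \<Longrightarrow> r div y < x" "r < x * y \<Longrightarrow> r mod y < y" for r x y :: nat
    by (metis less_mult_imp_div_less) (metis gr0I mod_less_divisor mult_0_right not_less_zero)
  show "kron (c \<cdot>\<^sub>m A) B = c \<cdot>\<^sub>m kron A B" "kron A (c \<cdot>\<^sub>m B) = c \<cdot>\<^sub>m kron A B"
    by (auto simp: kron_def intro!: eq_matI)
qed

lemma site_aux_op_smult: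
  assumes n: "n \<in> {1..sites P}" and M: "M \<in> carrier_mat (2 * (twospin P n + 1)) (2 * (twospin P n + 1))"
  shows "site_aux_op P n (c \<cdot>\<^sub>m M) = c \<cdot>\<^sub>m site_aux_op P n M"
proof -
  have b: "aux_block (c \<cdot>\<^sub>m M) a b = c \<cdot>\<^sub>m aux_block M a b" if "a < 2" "b < 2" for a b
    using M that by (auto simp: aux_block_def intro!: eq_matI)
  have s: "site_op P n (c \<cdot>\<^sub>m x) = c \<cdot>\<^sub>m site_op P n x" for x
    by (simp add: site_op_def kron_smult)
  have d: "dim_row (site_op P n (aux_block M a b)) = qdim P" "dim_col (site_op P n (aux_block M a b)) = qdim P"
    for a b using site_op_dim[OF n, of "aux_block M a b"] M by (auto simp: aux_block_def)
  show ?thesis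
    by (rule eq_matI) (auto simp: site_aux_op_def b s d aux_op_def)
qed

lemma site_aux_op_carrier: "site_aux_op P n M \<in> carrier_mat (2 * qdim P) (2 * qdim P)"
  by (simp add: site_aux_op_def aux_op_def)

lemma dressed_carrier:
  assumes "K \<in> carrier_mat m m" "\<And>n. A n \<in> carrier_mat m m" "\<And>n. B n \<in> carrier_mat m m"
  shows "dressed A B K n \<in> carrier_mat m m"
  using assms by (induction n) (auto intro!: mult_carrier_mat)

lemma smult_mult_smult:
  fixes a b :: "'a::comm_ring_1"
  assumes "A \<in> carrier_mat m m" "B \<in> carrier_mat m m"
  shows "(a \<cdot>\<^sub>m A) * (b \<cdot>\<^sub>m B) = (a * b) \<cdot>\<^sub>m (A * B)"
  using mult_smult_distrib[of "a \<cdot>\<^sub>m A" m m B m b] mult_smult_assoc_mat[of A m m B m a] assms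
  by (simp add: smult_smult_mat mult.commute)

lemma dressed_smult:
  assumes K: "K \<in> carrier_mat m m" and A: "\<And>n. A n \<in> carrier_mat m m" and B: "\<And>n. B n \<in> carrier_mat m m"
    and "\<And>i. i \<in> {1..n} \<Longrightarrow> A' i = a i \<cdot>\<^sub>m A i" "\<And>i. i \<in> {1..n} \<Longrightarrow> B' i = b i \<cdot>\<^sub>m B i"
  shows "dressed A' B' K n = (\<Prod>i\<in>{1..n}. a i * b i :: complex) \<cdot>\<^sub>m dressed A B K n"
  using assms(4,5)
proof (induction n)
  case (Suc n)
  have D: "dressed A B K n \<in> carrier_mat m m" by (rule dressed_carrier[OF K A B])
  have "dressed A' B' K (Suc n) = (a (Suc n) \<cdot>\<^sub>m A (Suc n)) *
      ((\<Prod>i\<in>{1..n}. a i * b i) \<cdot>\<^sub>m dressed A B K n) * (b (Suc n) \<cdot>\<^sub>m B (Suc n))"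
    using Suc by simp
  also have "\<dots> = (a (Suc n) * (\<Prod>i\<in>{1..n}. a i * b i) * b (Suc n)) \<cdot>\<^sub>m dressed A B K (Suc n)"
    by (simp only: smult_mult_smult[OF A D] smult_mult_smult[OF mult_carrier_mat[OF A D] B] dressed.simps)
  also have "a (Suc n) * (\<Prod>i\<in>{1..n}. a i * b i) * b (Suc n) = (\<Prod>i\<in>{1..Suc n}. a i * b i)"
    by (simp add: prod.nat_ivl_Suc' mult_ac)
  finally show ?case .
qed (auto intro: eq_matI)

lemma sum_pairs: "(\<Sum>r<2 * d. f r) = (\<Sum>i<d. f (2 * i) + f (2 * i + 1))"
  for f :: "nat \<Rightarrow> 'a::comm_monoid_add"
  by (induction d) (simp_all add: add.assoc)

text \<open>Only the entries of \<open>1 \<otimes> K\<close> in the auxiliary space contribute, so the partial trace of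
  \<open>(1 \<otimes> K) X\<close> is the trace of a product of two-by-two matrices over \<open>End V\<close>.\<close>

lemma aux_trace_aux_op:
  assumes K: "K \<in> carrier_mat 2 2"
    and X: "A \<in> carrier_mat d d" "B \<in> carrier_mat d d" "C \<in> carrier_mat d d" "D \<in> carrier_mat d d"
  shows "aux_trace (kron (1\<^sub>m d) K * aux_op d A B C D) =
    K $$ (0, 0) \<cdot>\<^sub>m A + K $$ (0, 1) \<cdot>\<^sub>m C + K $$ (1, 0) \<cdot>\<^sub>m B + K $$ (1, 1) \<cdot>\<^sub>m D"
proof -
  have kr: "kron (1\<^sub>m d) K $$ (2 * i + a, 2 * k + b) = (if i = k then K $$ (a, b) else 0)"
    if "i < d" "k < d" "a < 2" "b < 2" for i k a b
    using kron_index[of i "1\<^sub>m d" a K k b] that K by (simp add: mult.commute)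
  have op: "aux_op d A B C D $$ (2 * i + a, 2 * k + b) =
      (if a = 0 then (if b = 0 then A else B) else (if b = 0 then C else D)) $$ (i, k)"
    if "i < d" "k < d" "a < 2" "b < 2" for i k a b
    using that by (simp add: aux_op_def)
  have entry: "(kron (1\<^sub>m d) K * aux_op d A B C D) $$ (2 * i + a, 2 * k + b) =
      K $$ (a, 0) * aux_op d A B C D $$ (2 * i, 2 * k + b) +
      K $$ (a, 1) * aux_op d A B C D $$ (2 * i + 1, 2 * k + b)"
    if ik: "i < d" "k < d" "a < 2" "b < 2" for i k a b
  proof -
    have "(kron (1\<^sub>m d) K * aux_op d A B C D) $$ (2 * i + a, 2 * k + b) =
      (\<Sum>r<2 * d. kron (1\<^sub>m d) K $$ (2 * i + a, r) * aux_op d A B C D $$ (r, 2 * k + b))"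
      using K ik by (simp add: scalar_prod_def aux_op_def atLeast0LessThan mult.commute)
    also have "\<dots> = (\<Sum>r<d. if r = i then
      K $$ (a, 0) * aux_op d A B C D $$ (2 * i, 2 * k + b) +
      K $$ (a, 1) * aux_op d A B C D $$ (2 * i + 1, 2 * k + b) else 0)"
      unfolding sum_pairs using kr[of i _ a 0] kr[of i _ a 1] ik by (intro sum.cong) auto
    finally show ?thesis using ik by simp
  qed
  show ?thesis
  proof (rule eq_matI)
    fix i k assume "i < dim_row (K $$ (0, 0) \<cdot>\<^sub>m A + K $$ (0, 1) \<cdot>\<^sub>m C + K $$ (1, 0) \<cdot>\<^sub>m B + K $$ (1, 1) \<cdot>\<^sub>m D)"
      "k < dim_col (K $$ (0, 0) \<cdot>\<^sub>m A + K $$ (0, 1) \<cdot>\<^sub>m C + K $$ (1, 0) \<cdot>\<^sub>m B + K $$ (1, 1) \<cdot>\<^sub>m D)"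
    then have ik: "i < d" "k < d" using X by auto
    let ?M = "kron (1\<^sub>m d) K * aux_op d A B C D"
    have "aux_trace ?M $$ (i, k) = ?M $$ (2 * i + 0, 2 * k + 0) + ?M $$ (2 * i + 1, 2 * k + 1)"
      using ik K by (simp add: aux_trace_def aux_block_def aux_op_def)
    also have "\<dots> = K $$ (0, 0) * A $$ (i, k) + K $$ (0, 1) * C $$ (i, k) +
        (K $$ (1, 0) * B $$ (i, k) + K $$ (1, 1) * D $$ (i, k))"
      using entry[OF ik, of 0 0] entry[OF ik, of 1 1] op[OF ik, of 0 0] op[OF ik, of 1 0]
        op[OF ik, of 0 1] op[OF ik, of 1 1] by simp
    finally show "aux_trace ?M $$ (i, k) = (K $$ (0, 0) \<cdot>\<^sub>m A + K $$ (0, 1) \<cdot>\<^sub>m C +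
        K $$ (1, 0) \<cdot>\<^sub>m B + K $$ (1, 1) \<cdot>\<^sub>m D) $$ (i, k)"
      using ik X by simp
  qed (use X K in \<open>auto simp: aux_trace_def aux_block_def aux_op_def\<close>)
qed

section \<open>The quotient algebras\<close>

lemma Fring_simps [simp]:
  "carrier Fring = UNIV"
  by (simp add: ring_of_type_algebra_def)

lemma ring_Fring: "ring Fring"
proof -
  have "\<exists>y. x + y = 0" "\<exists>y. y + x = 0" for x :: free_alg
    using add.right_inverse add.left_inverse by blast+
  then show ?thesis
    unfolding ring_of_type_algebra_def
    by unfold_locales (auto simp: algebra_simps Units_def)
qed

lemma ideal_Aq_ideal: "ideal (Aq_ideal P) Fring"
  unfolding Aq_ideal_def by (rule ring.genideal_ideal[OF ring_Fring]) simp

lemma ring_Aq: "ring (Aq P)"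
  unfolding Aq_def by (rule ideal.quotient_is_ring[OF ideal_Aq_ideal])

lemma Aq_class_hom: "Aq_class P \<in> Ring.ring_hom Fring (Aq P)"
  using ideal.rcos_ring_hom[OF ideal_Aq_ideal] by (simp add: Aq_class_def[abs_def] Aq_def)

lemma Aq_class_closed: "Aq_class P x \<in> carrier (Aq P)"
  using ring_hom_closed[OF Aq_class_hom] by simp

lemma Aq_closed: "Aq_gen P g \<in> carrier (Aq P)" "Aq_const P z \<in> carrier (Aq P)"
  "x \<in> carrier (Aq P) \<Longrightarrow> Aq_smult P z x \<in> carrier (Aq P)"
  using ring.ring_simprules(5)[OF ring_Aq]
  by (simp_all add: Aq_gen_def Aq_const_def Aq_smult_def Aq_class_closed)

lemma AqN_rels_carrier: "AqN_rels P \<subseteq> carrier (Aq P)"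
proof -
  interpret ring "Aq P" by (rule ring_Aq)
  show ?thesis
    by (auto simp: AqN_rels_def Let_def intro!: finsum_closed a_closed Aq_closed)
qed

lemma ideal_AqN_ideal: "ideal (AqN_ideal P) (Aq P)"
  unfolding AqN_ideal_def by (rule ring.genideal_ideal[OF ring_Aq AqN_rels_carrier])

lemma ring_AqN: "ring (AqN P)"
  unfolding AqN_def by (rule ideal.quotient_is_ring[OF ideal_AqN_ideal])

lemma AqN_class_hom: "AqN_class P \<in> Ring.ring_hom (Aq P) (AqN P)"
  using ideal.rcos_ring_hom[OF ideal_AqN_ideal] by (simp add: AqN_class_def[abs_def] AqN_def)

lemma AqN_class_add:
  "x \<in> carrier (Aq P) \<Longrightarrow> y \<in> carrier (Aq P) \<Longrightarrow>
    AqN_class P (x \<oplus>\<^bsub>Aq P\<^esub> y) = AqN_class P x \<oplus>\<^bsub>AqN P\<^esub> AqN_class P y"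
  using ring_hom_add[OF AqN_class_hom] .

lemma AqN_class_smult:
  "x \<in> carrier (Aq P) \<Longrightarrow> AqN_class P (Aq_smult P z x) = AqN_smult P z (AqN_class P x)"
  using ring_hom_mult[OF AqN_class_hom] by (simp add: Aq_smult_def AqN_smult_def AqN_const_def Aq_closed)

lemma AqN_closed:
  "AqN_gen P g \<in> carrier (AqN P)" "AqN_const P z \<in> carrier (AqN P)"
  "x \<in> carrier (AqN P) \<Longrightarrow> AqN_smult P z x \<in> carrier (AqN P)"
  using ring.ring_simprules(5)[OF ring_AqN] ring_hom_closed[OF AqN_class_hom]
  by (simp_all add: AqN_gen_def AqN_const_def AqN_smult_def Aq_closed)

lemma gser_closed: "gser P f u \<in> carrier (AqN P)"
proof -
  interpret ring "AqN P" by (rule ring_AqN)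
  show ?thesis unfolding gser_def by (intro finsum_closed Pi_I AqN_closed)
qed

text \<open>Written in this form, the image of a constant under \<open>\<psi>\<close> is determined by the compatibility of
  \<open>\<psi>\<close> with scalar multiples.\<close>

lemma AqN_const_eq: "AqN_const P z = AqN_smult P z \<one>\<^bsub>AqN P\<^esub>"
  using ring.ring_simprules(13)[OF ring_AqN, of "AqN_const P z" P] AqN_closed(2)[of P z]
  by (simp add: AqN_smult_def monoid.r_one[OF ring.is_monoid[OF ring_AqN]])

section \<open>Images of generating functions\<close>

lemma rep_hom:
  assumes "spin_chain_rep P \<psi>"
  shows rep_closed: "x \<in> carrier (AqN P) \<Longrightarrow> \<psi> x \<in> carrier_mat (qdim P) (qdim P)"
    and rep_add: "x \<in> carrier (AqN P) \<Longrightarrow> y \<in> carrier (AqN P) \<Longrightarrow> \<psi> (x \<oplus>\<^bsub>AqN P\<^esub> y) = \<psi> x + \<psi> y"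
    and rep_smult: "x \<in> carrier (AqN P) \<Longrightarrow> \<psi> (AqN_smult P z x) = z \<cdot>\<^sub>m \<psi> x"
    and rep_const: "\<psi> (AqN_const P z) = z \<cdot>\<^sub>m 1\<^sub>m (qdim P)"
proof -
  have hom: "\<psi> \<in> Ring.ring_hom (AqN P) (chain_End P)"
    and sm: "\<And>z x. x \<in> carrier (AqN P) \<Longrightarrow> \<psi> (AqN_smult P z x) = z \<cdot>\<^sub>m \<psi> x"
    using assms by (auto simp: spin_chain_rep_def)
  show "x \<in> carrier (AqN P) \<Longrightarrow> \<psi> x \<in> carrier_mat (qdim P) (qdim P)"
    using ring_hom_closed[OF hom] by (simp add: ring_mat_simps)
  show "x \<in> carrier (AqN P) \<Longrightarrow> y \<in> carrier (AqN P) \<Longrightarrow> \<psi> (x \<oplus>\<^bsub>AqN P\<^esub> y) = \<psi> x + \<psi> y"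
    using ring_hom_add[OF hom] by (simp add: ring_mat_simps)
  show "x \<in> carrier (AqN P) \<Longrightarrow> \<psi> (AqN_smult P z x) = z \<cdot>\<^sub>m \<psi> x"
    by (rule sm)
  show "\<psi> (AqN_const P z) = z \<cdot>\<^sub>m 1\<^sub>m (qdim P)"
    unfolding AqN_const_eq using sm[OF ring.ring_simprules(6)[OF ring_AqN]] ring_hom_one[OF hom]
    by (simp add: ring_mat_simps)
qed

lemma rep_minus:
  assumes "spin_chain_rep P \<psi>" "x \<in> carrier (AqN P)" "y \<in> carrier (AqN P)"
  shows "\<psi> (x \<ominus>\<^bsub>AqN P\<^esub> y) = \<psi> x - \<psi> y"
proof -
  interpret ring "AqN P" by (rule ring_AqN)
  have "(x \<ominus>\<^bsub>AqN P\<^esub> y) \<oplus>\<^bsub>AqN P\<^esub> y = x"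
    using assms(2,3) by (simp add: a_minus_def a_assoc l_neg)
  then have "\<psi> x = \<psi> (x \<ominus>\<^bsub>AqN P\<^esub> y) + \<psi> y"
    using rep_add[OF assms(1), of "x \<ominus>\<^bsub>AqN P\<^esub> y" y] assms by simp
  moreover have "\<psi> (x \<ominus>\<^bsub>AqN P\<^esub> y) \<in> carrier_mat (qdim P) (qdim P)" "\<psi> y \<in> carrier_mat (qdim P) (qdim P)"
    using rep_closed[OF assms(1)] assms(2,3) by auto
  ultimately show ?thesis by auto
qed

lemma rep_gser:
  assumes "spin_chain_rep P \<psi>"
  shows "\<psi> (gser P f u) = (\<Oplus>\<^bsub>chain_End P\<^esub>k\<in>{0..<sites P}. Pfun P k u \<cdot>\<^sub>m \<psi> (AqN_gen P (f k)))"
proof -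
  have hom: "ring_hom_ring (AqN P) (chain_End P) \<psi>"
    using assms ring_AqN ring_mat by (intro ring_hom_ringI2) (auto simp: spin_chain_rep_def)
  interpret E: ring "chain_End P" by (rule ring_mat)
  show ?thesis
    unfolding gser_def
    by (subst ring_hom_ring.hom_finsum[OF hom])
      (auto intro!: AqN_closed E.finsum_cong' rep_smult[OF assms] simp: rep_smult[OF assms] AqN_closed
         ring_mat_simps rep_closed[OF assms])
qed

lemma rep_Iser:
  assumes "spin_chain_rep P \<psi>"
  shows "\<psi> (Iser P u) =
     epsbar_plus P \<cdot>\<^sub>m \<psi> (gser P Wm u) + epsbar_minus P \<cdot>\<^sub>m \<psi> (gser P Wp u) +
     (1 / (qpar P ^ 2 - inverse (qpar P ^ 2))) \<cdot>\<^sub>m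
       ((kbar_plus P / k_plus P) \<cdot>\<^sub>m \<psi> (gser P Gt u) + (kbar_minus P / k_minus P) \<cdot>\<^sub>m \<psi> (gser P Gg u))"
  unfolding Iser_def
  by (simp add: rep_add[OF assms] rep_smult[OF assms] AqN_closed gser_closed ring.ring_simprules(1)[OF ring_AqN])

lemma rep_IoddN:
  assumes "spin_chain_rep P \<psi>"
  shows "\<psi> (IoddN P k) =
          epsbar_plus P \<cdot>\<^sub>m \<psi> (AqN_gen P (Wm k)) +
          epsbar_minus P \<cdot>\<^sub>m \<psi> (AqN_gen P (Wp k)) +
          (1 / (qpar P ^ 2 - inverse (qpar P ^ 2)) * (kbar_minus P / k_minus P)) \<cdot>\<^sub>m
            \<psi> (AqN_gen P (Gg k)) +
          (1 / (qpar P ^ 2 - inverse (qpar P ^ 2)) * (kbar_plus P / k_plus P)) \<cdot>\<^sub>m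
            \<psi> (AqN_gen P (Gt k))"
proof -
  note add = ring.ring_simprules(1)
  have "IoddN P k = AqN_smult P (epsbar_plus P) (AqN_gen P (Wm k)) \<oplus>\<^bsub>AqN P\<^esub>
     AqN_smult P (epsbar_minus P) (AqN_gen P (Wp k)) \<oplus>\<^bsub>AqN P\<^esub>
     AqN_smult P (1 / (qpar P ^ 2 - inverse (qpar P ^ 2)))
       (AqN_smult P (kbar_minus P / k_minus P) (AqN_gen P (Gg k)) \<oplus>\<^bsub>AqN P\<^esub>
        AqN_smult P (kbar_plus P / k_plus P) (AqN_gen P (Gt k)))"
    by (simp add: IoddN_def Iodd_def AqN_gen_def AqN_class_add AqN_class_smult Aq_closed add[OF ring_Aq])
  moreover have "dim_row (\<psi> (AqN_gen P g)) = qdim P" "dim_col (\<psi> (AqN_gen P g)) = qdim P" for g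
    using rep_closed[OF assms AqN_closed(1)[of P g]] by auto
  ultimately show ?thesis
    by (simp add: rep_add[OF assms] rep_smult[OF assms] AqN_closed add[OF ring_AqN])
      (auto simp: algebra_simps intro!: eq_matI)
qed

lemma finsum_mat_index:
  assumes "finite A" "\<And>k. k \<in> A \<Longrightarrow> f k \<in> carrier_mat n n" "r < n" "s < n"
  shows "(\<Oplus>\<^bsub>ring_mat TYPE('a::comm_ring_1) n b\<^esub>k\<in>A. f k) $$ (r, s) = (\<Sum>k\<in>A. f k $$ (r, s))"
proof -
  interpret ring "ring_mat TYPE('a) n b" by (rule ring_mat)
  show ?thesis
    using assms(1,2)
  proof (induction A)
    case (insert x A)
    then have f: "f x \<in> carrier_mat n n" "f \<in> A \<rightarrow> carrier (ring_mat TYPE('a) n b)"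
      by (auto simp: ring_mat_simps)
    have "(\<Oplus>\<^bsub>ring_mat TYPE('a) n b\<^esub>k\<in>A. f k) \<in> carrier_mat n n"
      using finsum_closed[OF f(2)] by (simp add: ring_mat_simps)
    with insert f show ?case
      using assms(3,4) by (subst finsum_insert) (auto simp: ring_mat_simps)
  qed (use assms in \<open>simp add: ring_mat_simps\<close>)
qed

lemma rep_Iser_expansion:
  assumes "spin_chain_rep P \<psi>"
  shows "\<psi> (Iser P u) = (\<Oplus>\<^bsub>chain_End P\<^esub>k\<in>{0..<sites P}. Pfun P k u \<cdot>\<^sub>m \<psi> (IoddN P k))" (is "_ = ?S")
proof -
  interpret ring "chain_End P" by (rule ring_mat)
  have c: "\<psi> (AqN_gen P g) \<in> carrier_mat (qdim P) (qdim P)" for g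
    by (rule rep_closed[OF assms AqN_closed(1)])
  have dim: "dim_row (\<psi> (AqN_gen P g)) = qdim P" "dim_col (\<psi> (AqN_gen P g)) = qdim P" for g
    using c[of g] by auto
  have g: "\<psi> (gser P f u) \<in> carrier_mat (qdim P) (qdim P)" for f
    by (rule rep_closed[OF assms gser_closed])
  have I: "Pfun P k u \<cdot>\<^sub>m \<psi> (IoddN P k) \<in> carrier_mat (qdim P) (qdim P)" for k
    unfolding rep_IoddN[OF assms] using c by auto
  have S: "?S \<in> carrier_mat (qdim P) (qdim P)"
    using finsum_closed[of "\<lambda>k. Pfun P k u \<cdot>\<^sub>m \<psi> (IoddN P k)" "{0..<sites P}"] I by (simp add: ring_mat_simps)
  have ge: "\<psi> (gser P f u) $$ (r, s) = (\<Sum>k\<in>{0..<sites P}. Pfun P k u * \<psi> (AqN_gen P (f k)) $$ (r, s))"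
    if "r < qdim P" "s < qdim P" for f r s
    unfolding rep_gser[OF assms] using c that by (subst finsum_mat_index) (auto simp: dim)
  show ?thesis
  proof (rule eq_matI)
    fix r s assume "r < dim_row ?S" "s < dim_col ?S"
    then have rs: "r < qdim P" "s < qdim P" using S by auto
    have "\<psi> (Iser P u) $$ (r, s) = epsbar_plus P * \<psi> (gser P Wm u) $$ (r, s) +
      epsbar_minus P * \<psi> (gser P Wp u) $$ (r, s) + (1 / (qpar P ^ 2 - inverse (qpar P ^ 2))) *
       ((kbar_plus P / k_plus P) * \<psi> (gser P Gt u) $$ (r, s) + (kbar_minus P / k_minus P) * \<psi> (gser P Gg u) $$ (r, s))"
      unfolding rep_Iser[OF assms] using g[of Wm] g[of Wp] g[of Gt] g[of Gg] rs by simp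
    also have "\<dots> = (\<Sum>k\<in>{0..<sites P}. (Pfun P k u \<cdot>\<^sub>m \<psi> (IoddN P k)) $$ (r, s))"
      unfolding ge[OF rs] sum_distrib_left sum.distrib[symmetric]
    proof (intro sum.cong refl, goal_cases)
      case (1 k)
      show ?case
        unfolding rep_IoddN[OF assms] using c[of "Wm k"] c[of "Wp k"] c[of "Gg k"] c[of "Gt k"] rs
        by (simp add: algebra_simps)
    qed
    also have "\<dots> = ?S $$ (r, s)"
      using I rs by (subst finsum_mat_index) auto
    finally show "\<psi> (Iser P u) $$ (r, s) = ?S $$ (r, s)" .
  qed (use S g in \<open>auto simp: rep_Iser[OF assms]\<close>)
qed

lemma rep_Kdiag:
  assumes "spin_chain_rep P \<psi>"
  shows "\<psi> (Kdiag P e1 e2 f g u) = (u * e1 + inverse u * e2) \<cdot>\<^sub>m 1\<^sub>m (qdim P) +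
    cc (u ^ 2) \<cdot>\<^sub>m ((u * qpar P) \<cdot>\<^sub>m \<psi> (gser P f u) - (inverse u * inverse (qpar P)) \<cdot>\<^sub>m \<psi> (gser P g u))"
  unfolding Kdiag_def
  by (simp add: rep_add[OF assms] rep_minus[OF assms] rep_smult[OF assms] rep_const[OF assms]
      AqN_closed gser_closed ring.ring_simprules(4)[OF ring_AqN])

lemma rep_Koff:
  assumes "spin_chain_rep P \<psi>"
  shows "\<psi> (Koff P k f u) = (cc (u ^ 2) / k) \<cdot>\<^sub>m
    ((k_plus P * k_minus P * (u ^ 2 * qpar P + inverse (u ^ 2) * inverse (qpar P)) /
        (qpar P - inverse (qpar P)) * Pfun P 0 u) \<cdot>\<^sub>m 1\<^sub>m (qdim P) +
     (1 / (qpar P + inverse (qpar P))) \<cdot>\<^sub>m \<psi> (gser P f u) -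
     (k_plus P * k_minus P * dcoef P 0 / (qpar P - inverse (qpar P))) \<cdot>\<^sub>m 1\<^sub>m (qdim P))"
  unfolding Koff_def
  by (simp add: rep_add[OF assms] rep_minus[OF assms] rep_smult[OF assms] rep_const[OF assms]
      AqN_closed gser_closed ring.ring_simprules(1,4)[OF ring_AqN])

section \<open>The transfer matrix\<close>

text \<open>Splitting off the constant term of \<open>h\<^sub>0\<close> as a polynomial in \<open>U\<close> leaves \<open>U\<close> times \<open>P\<^sub>0\<close>.\<close>

lemma h0_eq:
  assumes "qpar P + inverse (qpar P) \<noteq> 0"
  shows "(qpar P + inverse (qpar P)) * h0 P u =
    (u ^ 2 * qpar P + inverse (u ^ 2) * inverse (qpar P)) * Pfun P 0 u - dcoef P 0"
proof -
  have U: "u ^ 2 * qpar P + inverse (u ^ 2) * inverse (qpar P) = (qpar P + inverse (qpar P)) * Uvar P u"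
    using assms by (simp add: Uvar_def mult.commute)
  have "(\<Sum>k\<in>{0..sites P}. dcoef P k * Uvar P u ^ k) =
      dcoef P 0 + Uvar P u * (\<Sum>n\<in>{0..<sites P}. dcoef P (n + 1) * Uvar P u ^ n)"
    by (simp add: atLeast0AtMost atLeast0LessThan lessThan_Suc_atMost[symmetric]
        sum.lessThan_Suc_shift sum_distrib_left mult_ac del: sum.lessThan_Suc)
  then show ?thesis
    unfolding U using assms by (simp add: h0_def Pfun_def field_simps)
qed

text \<open>In the next two lemmas, \<open>i\<close>, \<open>x\<close>, \<open>y\<close>, \<open>g\<close> stand for matrix elements of the identity and of the
  images of the generating functions, and the first factors are entries of \<open>K\<^sup>+(u)\<close>.
  The diagonal one comes from the entries \<open>\<A>\<close> and \<open>\<D>\<close>: the coefficient of \<open>a\<close> in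
  \<open>y\<close> and that of \<open>b\<close> in \<open>x\<close> cancel.\<close>

lemma diagonal_contribution:
  fixes u q a b ep em i x y :: complex
  assumes "u \<noteq> 0" "q \<noteq> 0"
  defines "w \<equiv> inverse u * inverse q"
  shows "(w * b + inverse w * a) * ((u * ep + inverse u * em) * i + cc (u ^ 2) * (u * q * x - inverse u * inverse q * y)) +
    (w * a + inverse w * b) * ((u * em + inverse u * ep) * i + cc (u ^ 2) * (u * q * y - inverse u * inverse q * x)) =
    cc (u ^ 2) * cc (u ^ 2 * q ^ 2) * (a * x + b * y) +
    (a * ((u ^ 2 * q + inverse (u ^ 2) * inverse q) * ep + (q + inverse q) * em) +
     b * ((u ^ 2 * q + inverse (u ^ 2) * inverse q) * em + (q + inverse q) * ep)) * i"
proof -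
  define v where "v = u * q"
  have w: "inverse w = v" "inverse u * inverse q = w" by (simp_all add: w_def v_def)
  have c2: "cc (u ^ 2 * q ^ 2) = v * v - w * w"
    by (simp add: cc_def v_def w_def power2_eq_square mult_ac)
  have e: "w * u = inverse q" "w * inverse u = inverse (u ^ 2) * inverse q" "v * inverse u = q" "v * u = u ^ 2 * q"
    using assms(1) by (simp_all add: w_def v_def power2_eq_square mult_ac)
  have W: "w * (u * e1 + inverse u * e2) = inverse q * e1 + inverse (u ^ 2) * inverse q * e2"
    "v * (u * e1 + inverse u * e2) = u ^ 2 * q * e1 + q * e2" for e1 e2
    unfolding distrib_left mult.assoc[symmetric] e by simp_all
  have 1: "(w * b + v * a) * (v * x - w * y) + (w * a + v * b) * (v * y - w * x) = (v * v - w * w) * (a * x + b * y)"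
    by (simp add: algebra_simps)
  have 2: "(w * b + v * a) * (u * ep + inverse u * em) + (w * a + v * b) * (u * em + inverse u * ep) =
    a * (v * (u * ep + inverse u * em) + w * (u * em + inverse u * ep)) +
    b * (v * (u * em + inverse u * ep) + w * (u * ep + inverse u * em))"
    by (simp only: distrib_left distrib_right mult_ac add_ac)
  have "(w * b + v * a) * ((u * ep + inverse u * em) * i + cc (u ^ 2) * (v * x - w * y)) +
    (w * a + v * b) * ((u * em + inverse u * ep) * i + cc (u ^ 2) * (v * y - w * x)) =
    cc (u ^ 2) * ((w * b + v * a) * (v * x - w * y) + (w * a + v * b) * (v * y - w * x)) +
    ((w * b + v * a) * (u * ep + inverse u * em) + (w * a + v * b) * (u * em + inverse u * ep)) * i"
    by (simp only: distrib_left distrib_right mult_ac add_ac)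
  also have "\<dots> = cc (u ^ 2) * (v * v - w * w) * (a * x + b * y) +
    (a * ((u ^ 2 * q + inverse (u ^ 2) * inverse q) * ep + (q + inverse q) * em) +
     b * ((u ^ 2 * q + inverse (u ^ 2) * inverse q) * em + (q + inverse q) * ep)) * i"
    unfolding 1 2 W by (simp only: distrib_left distrib_right mult_ac add_ac)
  finally show ?thesis unfolding w c2 v_def .
qed

text \<open>The off-diagonal entries of \<open>K\<^sup>+(u)\<close> contain \<open>c(u\<^sup>-\<^sup>2 q\<^sup>-\<^sup>2)\<close>, which is
  \<open>- c(u\<^sup>2 q\<^sup>2)\<close>; this sign is the one in front of \<open>c2\<close>. The assumption \<open>h\<close> has
  the form of \<open>h0_eq\<close>. Where \<open>q - inverse q\<close> vanishes, both sides are 0 because \<open>x / 0 = 0\<close>.\<close>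

lemma offdiagonal_contribution:
  fixes q d p i g kb c1 c2 z kp km k h :: complex
  assumes "q + inverse q \<noteq> 0" and h: "(q + inverse q) * h = z * p - d"
  shows "- kb * (- c2) / (q - inverse q) *
     (c1 / k * (kp * km * z / (q - inverse q) * p * i + 1 / (q + inverse q) * g - kp * km * d / (q - inverse q) * i)) =
    c1 * c2 * (1 / (q ^ 2 - inverse (q ^ 2)) * (kb / k * g) +
      h * (kp * km * (q + inverse q) ^ 2 / ((q - inverse q) * (q ^ 2 - inverse (q ^ 2))) * (kb / k)) * i)"
proof -
  define m s where ms_def: "m = q - inverse q" "s = q + inverse q"
  have ms: "q ^ 2 - inverse (q ^ 2) = m * s"
    by (simp add: ms_def power2_eq_square algebra_simps)
  have s: "s \<noteq> 0" using assms(1) by (simp add: ms_def)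
  then have s2: "s ^ 2 / (m * (m * s)) = s / (m * m)" by (simp add: power2_eq_square)
  have "kp * km * z / m * p * i + 1 / s * g - kp * km * d / m * i = kp * km * (z * p - d) / m * i + g / s"
    by (simp add: algebra_simps diff_divide_distrib)
  also have "z * p - d = s * h" using h by (simp add: ms_def)
  finally have e: "kp * km * z / m * p * i + 1 / s * g - kp * km * d / m * i = kp * km * (s * h) / m * i + g / s" .
  have "kp * km * s ^ 2 / (m * (m * s)) = kp * km * (s / (m * m))"
    using s2 by (metis times_divide_eq_right)
  then show ?thesis
    unfolding ms ms_def[symmetric] e by (simp add: algebra_simps add_divide_distrib)
qed

lemma qpar_plus_inverse_nonzero:
  assumes "valid_spin_chain P"
  shows "qpar P + inverse (qpar P) \<noteq> 0"
proof
  have q: "qpar P \<noteq> 0" "qpar P ^ 4 \<noteq> 1"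
    using assms by (auto simp: valid_spin_chain_def not_root_of_unity_def)
  assume "qpar P + inverse (qpar P) = 0"
  then have "qpar P * (qpar P + inverse (qpar P)) = 0" by simp
  then have "qpar P ^ 2 + 1 = 0"
    using q(1) by (simp add: distrib_left power2_eq_square)
  then have "qpar P ^ 2 = - 1" by (simp add: add_eq_0_iff2)
  then have "(qpar P ^ 2) ^ 2 = 1" by simp
  with q(2) show False by (simp flip: power_mult)
qed

lemma Lop_carrier: "Lop s t u \<in> carrier_mat (2 * (t + 1)) (2 * (t + 1))"
  by (simp add: Lop_def Let_def aux_op_def)

lemma transfer_matrix_dressed_K:
  assumes P: "valid_spin_chain P" and u: "regular_point P u"
  shows "transfer_matrix P u =
    inverse (\<Prod>n\<in>{1..sites P}.
              cc (u * qhalf P ^ (twospin P n + 1) * inhom P n) *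
              cc (u * qhalf P ^ (twospin P n + 1) * inverse (inhom P n))) \<cdot>\<^sub>m
    aux_trace (aux_only P (K_plus P u) * dressed_K P u)"
proof -
  let ?a = "\<lambda>n v. inverse (cc (u * v * qhalf P ^ (twospin P n + 1)))"
  let ?K = "aux_only P (K_minus P u)"
  let ?m = "2 * qdim P"
  have s: "qhalf P \<noteq> 0" and t: "\<And>n. n \<in> {1..sites P} \<Longrightarrow> twospin P n \<ge> 1"
    using P by (auto simp: valid_spin_chain_def)
  have K: "?K \<in> carrier_mat ?m ?m" "aux_only P (K_plus P u) \<in> carrier_mat ?m ?m"
    by (intro carrier_matI; simp add: aux_only_def K_minus_def K_plus_def Kmat_def mat_of_rows_list_def)+
  have R: "site_aux_op P n (R_tilde (qhalf P) (twospin P n) (u * v)) =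
      ?a n v \<cdot>\<^sub>m site_aux_op P n (Lop (qhalf P) (twospin P n) (u * v))"
    if n: "n \<in> {1..sites P}" and "v = inhom P n \<or> v = inverse (inhom P n)" for n v
    using that u
    by (subst R_tilde_eq_Lop[OF s t[OF n]])
       (auto simp: regular_point_def site_aux_op_smult[OF n Lop_carrier])
  have "transfer_matrix P u = aux_trace (aux_only P (K_plus P u) *
      ((\<Prod>n\<in>{1..sites P}. ?a n (inhom P n) * ?a n (inverse (inhom P n))) \<cdot>\<^sub>m dressed_K P u))"
    unfolding transfer_matrix_def dressed_K_def
    by (subst dressed_smult[OF K(1) site_aux_op_carrier site_aux_op_carrier]) (use R in auto)
  also have "(\<Prod>n\<in>{1..sites P}. ?a n (inhom P n) * ?a n (inverse (inhom P n))) =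
      inverse (\<Prod>n\<in>{1..sites P}.
              cc (u * qhalf P ^ (twospin P n + 1) * inhom P n) *
              cc (u * qhalf P ^ (twospin P n + 1) * inverse (inhom P n)))"
    unfolding prod_inversef[symmetric] by (intro prod.cong) (simp_all add: mult_ac)
  moreover have "dressed_K P u \<in> carrier_mat ?m ?m"
    unfolding dressed_K_def by (intro dressed_carrier K site_aux_op_carrier)
  moreover have "aux_trace (c \<cdot>\<^sub>m M) = c \<cdot>\<^sub>m aux_trace M" if "M \<in> carrier_mat ?m ?m" for c and M :: "complex mat"
    using that by (auto simp: aux_trace_def aux_block_def algebra_simps intro!: eq_matI)
  ultimately show ?thesis
    using K(2) by (simp add: mult_smult_distrib[of _ ?m ?m])
qed

text \<open>Comparison of matrix elements, after inserting the entries of \<open>K\<^sup>+(u)\<close> and of the K-operator.\<close>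

lemma aux_trace_dressed_K:
  fixes P :: spin_chain and \<psi> :: "free_alg set set \<Rightarrow> complex mat"
  assumes "valid_spin_chain P"
    and "spin_chain_rep P \<psi>"
    and u: "u \<noteq> 0"
  shows "aux_trace (aux_only P (K_plus P u) * dressed_K P u) =
          ((cc (u ^ 2) * cc (u ^ 2 * qpar P ^ 2)) \<cdot>\<^sub>m
             (\<psi> (Iser P u) + (h0 P u * I0 P) \<cdot>\<^sub>m 1\<^sub>m (qdim P)) +
           (epsbar_plus P *
              ((u ^ 2 * qpar P + inverse (u ^ 2) * inverse (qpar P)) * eps_plus_at P (sites P) +
               (qpar P + inverse (qpar P)) * eps_minus_at P (sites P)) +
            epsbar_minus P *
              ((u ^ 2 * qpar P + inverse (u ^ 2) * inverse (qpar P)) * eps_minus_at P (sites P) +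
               (qpar P + inverse (qpar P)) * eps_plus_at P (sites P))) \<cdot>\<^sub>m 1\<^sub>m (qdim P))" (is "_ = ?R")
proof -
  let ?q = "qpar P" and ?d = "qdim P"
  have q: "?q \<noteq> 0"
    using assms(1) by (simp add: valid_spin_chain_def)
  note q' = qpar_plus_inverse_nonzero[OF assms(1)]
  have g: "\<psi> (gser P f u) \<in> carrier_mat ?d ?d" for f
    by (rule rep_closed[OF assms(2) gser_closed])
  have dK: "dressed_K P u = aux_op ?d (\<psi> (KopA P u)) (\<psi> (KopB P u)) (\<psi> (KopC P u)) (\<psi> (KopD P u))"
    using assms(2) u by (simp add: spin_chain_rep_def)
  note Kops = KopA_def KopB_def KopC_def KopD_def rep_Kdiag[OF assms(2)] rep_Koff[OF assms(2)]
  have Kc: "\<psi> (KopA P u) \<in> carrier_mat ?d ?d" "\<psi> (KopB P u) \<in> carrier_mat ?d ?d"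
    "\<psi> (KopC P u) \<in> carrier_mat ?d ?d" "\<psi> (KopD P u) \<in> carrier_mat ?d ?d"
    unfolding Kops using carrier_matD[OF g] by (intro carrier_matI; simp)+
  define w where "w = inverse u * inverse ?q"
  have w2: "cc (w ^ 2) = - cc (u ^ 2 * ?q ^ 2)"
    by (simp add: w_def cc_def power_mult_distrib power_inverse)
  have Kp: "K_plus P u \<in> carrier_mat 2 2"
    "K_plus P u $$ (0, 0) = w * epsbar_minus P + inverse w * epsbar_plus P"
    "K_plus P u $$ (0, 1) = - kbar_plus P * (- cc (u ^ 2 * ?q ^ 2)) / (?q - inverse ?q)"
    "K_plus P u $$ (1, 0) = - kbar_minus P * (- cc (u ^ 2 * ?q ^ 2)) / (?q - inverse ?q)"
    "K_plus P u $$ (1, 1) = w * epsbar_plus P + inverse w * epsbar_minus P"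
    unfolding w2[symmetric] by (auto simp: K_plus_def Kmat_def mat_of_rows_list_def w_def)
  have "aux_trace (aux_only P (K_plus P u) * dressed_K P u) =
    K_plus P u $$ (0, 0) \<cdot>\<^sub>m \<psi> (KopA P u) + K_plus P u $$ (0, 1) \<cdot>\<^sub>m \<psi> (KopC P u) +
    K_plus P u $$ (1, 0) \<cdot>\<^sub>m \<psi> (KopB P u) + K_plus P u $$ (1, 1) \<cdot>\<^sub>m \<psi> (KopD P u)"
    unfolding dK aux_only_def by (rule aux_trace_aux_op[OF Kp(1) Kc])
  also have "\<dots> = ?R"
  proof (rule eq_matI)
    fix r s assume "r < dim_row ?R" "s < dim_col ?R"
    then have rs: "r < ?d" "s < ?d" by auto
    \<comment> \<open>Only the matrix elements \<open>i\<close> and \<open>x f\<close> at the position \<open>(r, s)\<close> enter from here on; the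
      simplifier must not evaluate \<open>i\<close> to a case distinction.\<close>
    define i where "i = (1\<^sub>m ?d :: complex mat) $$ (r, s)"
    define x where "x = (\<lambda>f. \<psi> (gser P f u) $$ (r, s))"
    let ?c1 = "cc (u ^ 2)" and ?c2 = "cc (u ^ 2 * ?q ^ 2)"
    let ?X = "u ^ 2 * ?q + inverse (u ^ 2) * inverse ?q"
    let ?kk = "k_plus P * k_minus P"
    have gx: "dim_row (\<psi> (gser P f u)) = ?d" "dim_col (\<psi> (gser P f u)) = ?d" 
        "\<psi> (gser P f u) $$ (r, s) = x f" for f
      using g by (auto simp: x_def)
    have ii: "1\<^sub>m ?d $$ (r, s) = i" by (simp add: i_def)
    note ix = index_add_mat index_minus_mat index_smult_mat gx ii index_one_mat(2,3)
    have Kdiag: "\<psi> (Kdiag P e1 e2 f f' u) $$ (r, s) = (u * e1 + inverse u * e2) * i +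
      ?c1 * (u * ?q * x f - inverse u * inverse ?q * x f')" for e1 e2 f f'
      unfolding rep_Kdiag[OF assms(2)] using rs by (simp add: ix del: index_one_mat(1))
    have Koff: "\<psi> (Koff P kk f u) $$ (r, s) = ?c1 / kk *
       (?kk * ?X / (?q - inverse ?q) * Pfun P 0 u * i + 1 / (?q + inverse ?q) * x f -
        ?kk * dcoef P 0 / (?q - inverse ?q) * i)" for kk f
      unfolding rep_Koff[OF assms(2)] using rs by (simp add: ix del: index_one_mat(1))
    have I: "\<psi> (Iser P u) $$ (r, s) = epsbar_plus P * x Wm + epsbar_minus P * x Wp +
       1 / (?q ^ 2 - inverse (?q ^ 2)) * (kbar_plus P / k_plus P * x Gt + kbar_minus P / k_minus P * x Gg)"
      and Id: "dim_row (\<psi> (Iser P u)) = ?d" "dim_col (\<psi> (Iser P u)) = ?d"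
      unfolding rep_Iser[OF assms(2)] using rs by (simp_all add: ix)
    note off = offdiagonal_contribution[OF q' h0_eq[OF q', of u]]
    have diag: "K_plus P u $$ (0, 0) * \<psi> (KopA P u) $$ (r, s) + K_plus P u $$ (1, 1) * \<psi> (KopD P u) $$ (r, s) =
      ?c1 * ?c2 * (epsbar_plus P * x Wm + epsbar_minus P * x Wp) +
      (epsbar_plus P * (?X * eps_plus_at P (sites P) + (?q + inverse ?q) * eps_minus_at P (sites P)) +
       epsbar_minus P * (?X * eps_minus_at P (sites P) + (?q + inverse ?q) * eps_plus_at P (sites P))) * i"
      unfolding Kp KopA_def KopD_def Kdiag w_def by (rule diagonal_contribution[OF u q])
    have "(K_plus P u $$ (0, 0) \<cdot>\<^sub>m \<psi> (KopA P u) + K_plus P u $$ (0, 1) \<cdot>\<^sub>m \<psi> (KopC P u) +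
      K_plus P u $$ (1, 0) \<cdot>\<^sub>m \<psi> (KopB P u) + K_plus P u $$ (1, 1) \<cdot>\<^sub>m \<psi> (KopD P u)) $$ (r, s) =
      (K_plus P u $$ (0, 0) * \<psi> (KopA P u) $$ (r, s) + K_plus P u $$ (1, 1) * \<psi> (KopD P u) $$ (r, s)) +
      K_plus P u $$ (0, 1) * \<psi> (KopC P u) $$ (r, s) + K_plus P u $$ (1, 0) * \<psi> (KopB P u) $$ (r, s)"
      using Kc rs by simp
    also have "\<dots> = ?c1 * ?c2 * (\<psi> (Iser P u) $$ (r, s) + h0 P u * I0 P * i) +
      (epsbar_plus P * (?X * eps_plus_at P (sites P) + (?q + inverse ?q) * eps_minus_at P (sites P)) +
       epsbar_minus P * (?X * eps_minus_at P (sites P) + (?q + inverse ?q) * eps_plus_at P (sites P))) * i"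
      unfolding diag Kp(3,4) KopB_def KopC_def Koff off I I0_def rho_def
      by (simp only: distrib_left distrib_right mult_ac add_ac)
    also have "\<dots> = ?R $$ (r, s)"
      using rs by (simp add: ix Id del: index_one_mat(1))
    finally show "(K_plus P u $$ (0, 0) \<cdot>\<^sub>m \<psi> (KopA P u) + K_plus P u $$ (0, 1) \<cdot>\<^sub>m \<psi> (KopC P u) +
      K_plus P u $$ (1, 0) \<cdot>\<^sub>m \<psi> (KopB P u) + K_plus P u $$ (1, 1) \<cdot>\<^sub>m \<psi> (KopD P u)) $$ (r, s) =
      ?R $$ (r, s)" .
  qed (use Kc in auto)
  finally show ?thesis .
qed

section \<open>The transfer matrix in terms of the generating function\<close>

theorem proposition5p9:
  fixes P :: spin_chain and \<psi> :: "free_alg set set \<Rightarrow> complex mat"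
  assumes "valid_spin_chain P"
    and "spin_chain_rep P \<psi>"
  shows
    "(\<forall>u. regular_point P u \<longrightarrow>
        transfer_matrix P u =
          inverse (\<Prod>n\<in>{1..sites P}.
              cc (u * qhalf P ^ (twospin P n + 1) * inhom P n) *
              cc (u * qhalf P ^ (twospin P n + 1) * inverse (inhom P n))) \<cdot>\<^sub>m
          ((cc (u ^ 2) * cc (u ^ 2 * qpar P ^ 2)) \<cdot>\<^sub>m
             (\<psi> (Iser P u) + (h0 P u * I0 P) \<cdot>\<^sub>m 1\<^sub>m (qdim P)) +
           (epsbar_plus P *
              ((u ^ 2 * qpar P + inverse (u ^ 2) * inverse (qpar P)) * eps_plus_at P (sites P) +
               (qpar P + inverse (qpar P)) * eps_minus_at P (sites P)) +
            epsbar_minus P *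
              ((u ^ 2 * qpar P + inverse (u ^ 2) * inverse (qpar P)) * eps_minus_at P (sites P) +
               (qpar P + inverse (qpar P)) * eps_plus_at P (sites P))) \<cdot>\<^sub>m 1\<^sub>m (qdim P))) \<and>
     (\<forall>u. u \<noteq> 0 \<longrightarrow>
        \<psi> (Iser P u) =
          (\<Oplus>\<^bsub>chain_End P\<^esub>k\<in>{0..<sites P}. Pfun P k u \<cdot>\<^sub>m \<psi> (IoddN P k))) \<and>
     (\<forall>k.
        \<psi> (IoddN P k) =
          epsbar_plus P \<cdot>\<^sub>m \<psi> (AqN_gen P (Wm k)) +
          epsbar_minus P \<cdot>\<^sub>m \<psi> (AqN_gen P (Wp k)) +
          (1 / (qpar P ^ 2 - inverse (qpar P ^ 2)) * (kbar_minus P / k_minus P)) \<cdot>\<^sub>m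
            \<psi> (AqN_gen P (Gg k)) +
          (1 / (qpar P ^ 2 - inverse (qpar P ^ 2)) * (kbar_plus P / k_plus P)) \<cdot>\<^sub>m
            \<psi> (AqN_gen P (Gt k)))"
proof (intro conjI allI impI)
  fix u assume "regular_point P u"
  then show "transfer_matrix P u =
          inverse (\<Prod>n\<in>{1..sites P}.
              cc (u * qhalf P ^ (twospin P n + 1) * inhom P n) *
              cc (u * qhalf P ^ (twospin P n + 1) * inverse (inhom P n))) \<cdot>\<^sub>m
          ((cc (u ^ 2) * cc (u ^ 2 * qpar P ^ 2)) \<cdot>\<^sub>m
             (\<psi> (Iser P u) + (h0 P u * I0 P) \<cdot>\<^sub>m 1\<^sub>m (qdim P)) +
           (epsbar_plus P *
              ((u ^ 2 * qpar P + inverse (u ^ 2) * inverse (qpar P)) * eps_plus_at P (sites P) +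
               (qpar P + inverse (qpar P)) * eps_minus_at P (sites P)) +
            epsbar_minus P *
              ((u ^ 2 * qpar P + inverse (u ^ 2) * inverse (qpar P)) * eps_minus_at P (sites P) +
               (qpar P + inverse (qpar P)) * eps_plus_at P (sites P))) \<cdot>\<^sub>m 1\<^sub>m (qdim P))"
    unfolding transfer_matrix_dressed_K[OF assms(1) \<open>regular_point P u\<close>]
    by (subst aux_trace_dressed_K[OF assms]) (simp_all add: regular_point_def)
qed (rule rep_Iser_expansion[OF assms(2)] rep_IoddN[OF assms(2)])+

end
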